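(* Let $R$ be an integral domain, and consider the set of all cubic surfaces $\{S_{a,b}: a,b\in P_3^\times(R)\}$. Then the groupoid of $R$-isomorphisms between the surfaces $S_{a,b}$ is generated by (1) linear isomorphisms, (2) $\sigma_y:S_{a,b}\cong S_{\bar a,b}$ for all $a,b\in P_3^\times(R)$, and (3) $\sigma_x:S_{a,b}\cong S_{a,\bar b}$ for all $a,b\in P_3^\times(R)$. That is, every $R$-isomorphism $S_{a,b}\cong S_{a',b'}$ with $a,b,a',b'\in P_3^\times(R)$ is a finite composition of isomorphisms of types (1), (2), (3) between surfaces of this family.
   Context: $P_3^\times(R)$ is the set of polynomials $a(t)=a_3t^3+a_2t^2+a_1t+a_0\in R[t]$ with $a_3,a_0\in R^\times$. For $a\in P_3^\times(R)$ define $a^*(t)$ by $a(t)=t\,a^*(t)+a_0$ and $\bar a(t):=\frac{1}{a_0^2a_3}t^3a\bigl(\tfrac{a_0}{t}\bigr)\in P_3^\times(R)$; then $\bar a(0)=a_0$ and $\bar{\bar a}=a$. For $a,b\in P_3^\times(R)$, $$S_{a,b}:=\bigl(xyz=b_0a(x)+a_0b(y)-a_0b_0\bigr)\subset\mathbb{A}^3_R .$$ Linear isomorphisms between two such surfaces are the isomorphisms of the form $(x,y,z)\mapsto(\lambda_xx,\lambda_yy,\lambda_zz)$ or $(x,y,z)\mapsto(\lambda_yy,\lambda_xx,\lambda_zz)$ with $\lambda_x,\lambda_y,\lambda_z\in R^\times$. $\sigma_y:S_{a,b}\to S_{\bar a,b}$ is $(x,y,z)\mapsto(x',y,z')$ with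 $x'=b_0^{-1}yz-a^*(x)$ (equal to $a_0b_0^{-1}b(y)/x$ where $x\ne0$) and $z'=b_0\bigl(\bar a^*(x')+x\bigr)/y$, which is a regular function on $S_{a,b}$; here $\bar a^*:=(\bar a)^*$. $\sigma_x:S_{a,b}\to S_{a,\bar b}$ is $(x,y,z)\mapsto(x,y',z')$ with $y'=a_0^{-1}xz-b^*(y)$ and $z'=a_0\bigl(\bar b^*(y')+y\bigr)/x$. These are $R$-isomorphisms. *)

theory Defs
  imports "HOL-Computational_Algebra.Computational_Algebra"
begin

section \<open>Cubics with invertible outer coefficients\<close>

definition unit_inv :: "'a::idom \<Rightarrow> 'a" where
  "unit_inv u = (THE v. u * v = 1)"

lemma unit_inv_mult:
  assumes "(u::'a::idom) dvd 1"
  shows "u * unit_inv u = 1"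
proof -
  obtain v where v: "u * v = 1" using assms by (metis dvdE)
  have "unit_inv u = v" unfolding unit_inv_def
  proof (rule the_equality)
    fix w assume "u * w = 1"
    then show "w = v" using v by (metis mult.commute mult.left_commute mult_1_right)
  qed (rule v)
  then show ?thesis using v by simp
qed

definition P3x :: "'a::idom poly set" where
  "P3x = {a. degree a = 3 \<and> coeff a 3 dvd 1 \<and> coeff a 0 dvd 1}"

definition star_poly :: "'a::idom poly \<Rightarrow> 'a poly" where
  "star_poly a = poly_shift 1 a"

lemma star_poly_decomp: "a = [:0, 1:] * star_poly a + [:coeff a 0:]"
  by (rule poly_eqI) (auto simp: star_poly_def coeff_poly_shift coeff_pCons split: nat.splits)

text \<open>Since \<open>reflect_poly p\<close> is \<open>t ^ degree p * p (1 / t)\<close>, and \<open>a (a\<^sub>0 t)\<close> has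
  degree 3 for \<open>a\<close> in \<open>P3x\<close>, the reflected polynomial below is \<open>t\<^sup>3 * a (a\<^sub>0 / t)\<close>.\<close>

definition bar_poly :: "'a::idom poly \<Rightarrow> 'a poly" where
  "bar_poly a = smult (unit_inv ((coeff a 0)\<^sup>2 * coeff a 3))
     (reflect_poly (pcompose a [:0, coeff a 0:]))"

lemma P3x_expand:
  assumes "a \<in> P3x"
  shows "a = [:coeff a 0, coeff a 1, coeff a 2, coeff a 3:]"
proof (rule poly_eqI)
  fix n
  have "degree a = 3" using assms by (simp add: P3x_def)
  then have "coeff a n = 0" if "n > 3" using that by (simp add: coeff_eq_0)
  then show "coeff a n = coeff [:coeff a 0, coeff a 1, coeff a 2, coeff a 3:] n"
    by (cases "n > 3") (auto simp: coeff_pCons numeral_eq_Suc less_Suc_eq not_less le_Suc_eq split: nat.splits)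
qed

lemma unit_inv_unique:
  assumes "(u::'a::idom) * v = 1"
  shows "unit_inv u = v"
proof -
  have "u dvd 1" using assms by (metis dvdI)
  then show ?thesis using unit_inv_mult[of u] assms
    by (metis mult.commute mult.left_commute mult_1_right)
qed

lemma P3xD:
  assumes "a \<in> P3x"
  shows "degree a = 3" "coeff a 0 * unit_inv (coeff a 0) = 1" "coeff a 3 * unit_inv (coeff a 3) = 1"
    "coeff a 0 \<noteq> 0" "coeff a 3 \<noteq> 0"
  using assms by (auto simp: P3x_def unit_inv_mult)

lemma bar_poly_expand:
  assumes "a \<in> P3x"
  shows "bar_poly a = [:coeff a 0, coeff a 2 * unit_inv (coeff a 3),
    coeff a 1 * unit_inv (coeff a 0 * coeff a 3), unit_inv (coeff a 0 * coeff a 3):]"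
proof -
  define a0 a3 u v where "a0 = coeff a 0" and "a3 = coeff a 3"
    and "u = unit_inv a0" and "v = unit_inv a3"
  have uv: "a0 * u = 1" "a3 * v = 1" "a0 \<noteq> 0" "a3 \<noteq> 0"
    using P3xD[OF assms] by (auto simp: a0_def a3_def u_def v_def)
  have w: "unit_inv (a0\<^sup>2 * a3) = u\<^sup>2 * v"
    by (rule unit_inv_unique) (use uv in algebra)
  have w': "unit_inv (a0 * a3) = u * v"
    by (rule unit_inv_unique) (use uv in algebra)
  have p: "pcompose a [:0, a0:] = [:a0, coeff a 1 * a0, coeff a 2 * a0\<^sup>2, a3 * a0^3:]"
    by (subst P3x_expand[OF assms])
      (simp add: pcompose_pCons a0_def a3_def power2_eq_square power3_eq_cube mult_ac)
  have c: "coeffs (pcompose a [:0, a0:]) = [a0, coeff a 1 * a0, coeff a 2 * a0\<^sup>2, a3 * a0^3]"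
    using uv by (simp add: p)
  have r: "reflect_poly (pcompose a [:0, a0:]) =
      [:a3 * a0^3, coeff a 2 * a0\<^sup>2, coeff a 1 * a0, a0:]"
    by (simp add: reflect_poly_def c)
  have e: "u\<^sup>2 * v * (a3 * a0^3) = a0" "u\<^sup>2 * v * (coeff a 2 * a0\<^sup>2) = coeff a 2 * v"
    "u\<^sup>2 * v * (coeff a 1 * a0) = coeff a 1 * (u * v)" "u\<^sup>2 * v * a0 = u * v"
    using uv by algebra+
  have "bar_poly a = smult (unit_inv (a0\<^sup>2 * a3)) (reflect_poly (pcompose a [:0, a0:]))"
    by (simp add: bar_poly_def a0_def a3_def)
  also have "\<dots> = [:a0, coeff a 2 * v, coeff a 1 * (u * v), u * v:]"
    unfolding r w smult_pCons e by simp
  finally show ?thesis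
    by (simp add: w'[symmetric]) (simp add: a0_def a3_def v_def)
qed

lemma bar_poly_in_P3x:
  assumes "a \<in> P3x"
  shows "bar_poly a \<in> P3x"
proof -
  have "coeff a 0 * coeff a 3 dvd 1"
    using mult_dvd_mono[of "coeff a 0" 1 "coeff a 3" 1] assms by (simp add: P3x_def)
  from unit_inv_mult[OF this] have u: "unit_inv (coeff a 0 * coeff a 3) dvd 1"
    by (metis dvd_triv_right)
  then have "unit_inv (coeff a 0 * coeff a 3) \<noteq> 0" by auto
  with u show ?thesis using assms
    by (simp add: bar_poly_expand P3x_def numeral_3_eq_3)
qed

section \<open>The surfaces and their morphisms\<close>

text \<open>\<open>R[x,y,z]\<close> is represented as \<open>R[x][y][z]\<close>, with \<open>x\<close> innermost.\<close>

type_synonym 'a poly3 = "'a poly poly poly"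

definition cst :: "'a::idom \<Rightarrow> 'a poly3" where "cst c = [:[:[:c:]:]:]"
definition vx :: "'a::idom poly3" where "vx = [:[:[:0, 1:]:]:]"
definition vy :: "'a::idom poly3" where "vy = [:[:0, 1:]:]"
definition vz :: "'a::idom poly3" where "vz = [:0, 1:]"

text \<open>Value of a univariate polynomial over \<open>R\<close> at an element of \<open>R[x,y,z]\<close>.\<close>

definition ev1 :: "'a::idom poly \<Rightarrow> 'a poly3 \<Rightarrow> 'a poly3" where
  "ev1 a p = poly (map_poly cst a) p"

text \<open>A triple of polynomials describes a map into affine 3-space, and \<open>subst3\<close> pulls back a
  function along it.\<close>

type_synonym 'a pmap = "'a poly3 \<times> 'a poly3 \<times> 'a poly3"

fun subst3 :: "'a::idom pmap \<Rightarrow> 'a poly3 \<Rightarrow> 'a poly3" where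
  "subst3 (X, Y, Z) f =
     poly (map_poly (\<lambda>g. poly (map_poly (\<lambda>h. ev1 h X) g) Y) f) Z"

lemma subst3_simps [simp]:
  "subst3 (X, Y, Z) (cst c) = cst c" "subst3 (X, Y, Z) vx = X"
  "subst3 (X, Y, Z) vy = Y" "subst3 (X, Y, Z) vz = Z"
  by (simp_all add: cst_def vx_def vy_def vz_def ev1_def map_poly_pCons one_pCons[symmetric])

definition id_pmap :: "'a::idom pmap" where "id_pmap = (vx, vy, vz)"

fun comp_pmap :: "'a::idom pmap \<Rightarrow> 'a pmap \<Rightarrow> 'a pmap" where
  "comp_pmap (X, Y, Z) \<phi> = (subst3 \<phi> X, subst3 \<phi> Y, subst3 \<phi> Z)"

definition surf :: "'a::idom poly \<Rightarrow> 'a poly \<Rightarrow> 'a poly3" where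
  "surf a b = vx * vy * vz - (cst (coeff b 0) * ev1 a vx + cst (coeff a 0) * ev1 b vy
     - cst (coeff a 0) * cst (coeff b 0))"

text \<open>The coordinate ring of \<open>S\<^sub>a\<^sub>,\<^sub>b\<close> is \<open>R[x,y,z]\<close> modulo \<open>surf a b\<close>. Morphisms
  \<open>S\<^sub>a\<^sub>,\<^sub>b \<rightarrow> S\<^sub>c\<^sub>,\<^sub>d\<close> over \<open>R\<close> are the triples of regular functions on
  \<open>S\<^sub>a\<^sub>,\<^sub>b\<close> that satisfy the equation of \<open>S\<^sub>c\<^sub>,\<^sub>d\<close>. Triples of polynomials represent
  them, and two triples represent the same morphism iff they agree modulo \<open>surf a b\<close>.
  Points with values in \<open>R\<close> would not do, as \<open>R\<close> may be finite.\<close>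

definition eq_on :: "'a::idom poly \<Rightarrow> 'a poly \<Rightarrow> 'a poly3 \<Rightarrow> 'a poly3 \<Rightarrow> bool" where
  "eq_on a b f g \<longleftrightarrow> surf a b dvd (f - g)"

fun pmap_eq_on :: "'a::idom poly \<Rightarrow> 'a poly \<Rightarrow> 'a pmap \<Rightarrow> 'a pmap \<Rightarrow> bool" where
  "pmap_eq_on a b (X, Y, Z) (X', Y', Z') \<longleftrightarrow>
     eq_on a b X X' \<and> eq_on a b Y Y' \<and> eq_on a b Z Z'"

definition surf_morphism ::
  "'a::idom poly \<Rightarrow> 'a poly \<Rightarrow> 'a poly \<Rightarrow> 'a poly \<Rightarrow> 'a pmap \<Rightarrow> bool" where
  "surf_morphism a b c d \<phi> \<longleftrightarrow> eq_on a b (subst3 \<phi> (surf c d)) 0"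

definition surf_iso ::
  "'a::idom poly \<Rightarrow> 'a poly \<Rightarrow> 'a poly \<Rightarrow> 'a poly \<Rightarrow> 'a pmap \<Rightarrow> bool" where
  "surf_iso a b c d \<phi> \<longleftrightarrow> surf_morphism a b c d \<phi> \<and>
     (\<exists>\<psi>. surf_morphism c d a b \<psi> \<and>
        pmap_eq_on a b (comp_pmap \<psi> \<phi>) id_pmap \<and>
        pmap_eq_on c d (comp_pmap \<phi> \<psi>) id_pmap)"

section \<open>The three types of generators\<close>

definition linear_iso ::
  "'a::idom poly \<Rightarrow> 'a poly \<Rightarrow> 'a poly \<Rightarrow> 'a poly \<Rightarrow> 'a pmap \<Rightarrow> bool" where
  "linear_iso a b c d \<phi> \<longleftrightarrow> surf_iso a b c d \<phi> \<and>
     (\<exists>lx ly lz. lx dvd 1 \<and> ly dvd 1 \<and> lz dvd 1 \<and>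
        (\<phi> = (cst lx * vx, cst ly * vy, cst lz * vz) \<or>
         \<phi> = (cst ly * vy, cst lx * vx, cst lz * vz)))"

text \<open>The third components of \<open>\<sigma>\<^sub>y\<close> and \<open>\<sigma>\<^sub>x\<close> are quotients by \<open>y\<close> and \<open>x\<close> in the
  coordinate ring of \<open>S\<^sub>a\<^sub>,\<^sub>b\<close>. Such a quotient exists and is unique in the coordinate ring
  (shown below for \<open>\<sigma>\<^sub>y\<close>; \<open>\<sigma>\<^sub>x\<close> is symmetric), and \<open>SOME\<close> picks a polynomial representing it.\<close>

definition sigma_y_x :: "'a::idom poly \<Rightarrow> 'a poly \<Rightarrow> 'a poly3" where
  "sigma_y_x a b = cst (unit_inv (coeff b 0)) * vy * vz - ev1 (star_poly a) vx"

definition sigma_y_z :: "'a::idom poly \<Rightarrow> 'a poly \<Rightarrow> 'a poly3" where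
  "sigma_y_z a b = (SOME w. eq_on a b (vy * w)
     (cst (coeff b 0) * (ev1 (star_poly (bar_poly a)) (sigma_y_x a b) + vx)))"

definition sigma_y :: "'a::idom poly \<Rightarrow> 'a poly \<Rightarrow> 'a pmap" where
  "sigma_y a b = (sigma_y_x a b, vy, sigma_y_z a b)"

definition sigma_x_y :: "'a::idom poly \<Rightarrow> 'a poly \<Rightarrow> 'a poly3" where
  "sigma_x_y a b = cst (unit_inv (coeff a 0)) * vx * vz - ev1 (star_poly b) vy"

definition sigma_x_z :: "'a::idom poly \<Rightarrow> 'a poly \<Rightarrow> 'a poly3" where
  "sigma_x_z a b = (SOME w. eq_on a b (vx * w)
     (cst (coeff a 0) * (ev1 (star_poly (bar_poly b)) (sigma_x_y a b) + vy)))"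

definition sigma_x :: "'a::idom poly \<Rightarrow> 'a poly \<Rightarrow> 'a pmap" where
  "sigma_x a b = (vx, sigma_x_y a b, sigma_x_z a b)"

lemma cst_simps:
  "cst 0 = 0" "cst 1 = 1" "cst (a + b) = cst a + cst b" "cst (a * b) = cst a * cst b"
  by (simp_all add: cst_def one_pCons)

lemma ev1_pCons: "ev1 (pCons c p) t = cst c + t * ev1 p t"
  by (simp add: ev1_def map_poly_pCons cst_simps)

lemma ev1_0 [simp]: "ev1 0 t = 0"
  by (simp add: ev1_def)

lemma ev1_decomp: "ev1 a t = t * ev1 (star_poly a) t + cst (coeff a 0)"
  by (subst (1) star_poly_decomp) (simp add: ev1_pCons)

lemma sigma_y_quotient_exists:
  assumes "a \<in> P3x" "b \<in> P3x"
  shows "\<exists>w. eq_on a b (vy * w)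
    (cst (coeff b 0) * (ev1 (star_poly (bar_poly a)) (sigma_y_x a b) + vx))"
proof -
  define a0 a1 a2 a3 b0 u v t where "a0 = cst (coeff a 0)" and "a1 = cst (coeff a 1)"
    and "a2 = cst (coeff a 2)" and "a3 = cst (coeff a 3)" and "b0 = cst (coeff b 0)"
    and "u = cst (unit_inv (coeff a 0))" and "v = cst (unit_inv (coeff a 3))"
    and "t = cst (unit_inv (coeff b 0))"
  note d = this
  have inv: "a0 * u = 1" "a3 * v = 1" "b0 * t = 1"
    using P3xD[OF assms(1)] P3xD[OF assms(2)] by (simp_all add: d cst_simps(4)[symmetric] cst_simps(2))
  have "unit_inv (coeff a 0 * coeff a 3) = unit_inv (coeff a 0) * unit_inv (coeff a 3)"
    by (rule unit_inv_unique) (use P3xD(2,3)[OF assms(1)] in algebra)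
  then have c: "cst (unit_inv (coeff a 0 * coeff a 3)) = u * v" by (simp add: d cst_simps)
  have star_bar: "star_poly (bar_poly a) = [:coeff a 2 * unit_inv (coeff a 3),
      coeff a 1 * unit_inv (coeff a 0 * coeff a 3), unit_inv (coeff a 0 * coeff a 3):]"
    by (rule poly_eqI) (simp add: bar_poly_expand[OF assms(1)] star_poly_def coeff_poly_shift)
  have star: "star_poly a = [:coeff a 1, coeff a 2, coeff a 3:]"
    by (subst P3x_expand[OF assms(1)], rule poly_eqI) (simp add: star_poly_def coeff_poly_shift)
  define s B where "s = a1 + vx * (a2 + vx * a3)" and "B = ev1 (star_poly b) vy"
  have X: "sigma_y_x a b = t * vy * vz - s"
    by (simp add: sigma_y_x_def star ev1_pCons d s_def)
  have E: "ev1 (star_poly (bar_poly a)) p = a2 * v + p * (a1 * (u * v) + p * (u * v))" for p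
    by (simp add: star_bar ev1_pCons cst_simps c) (simp add: d)
  have S: "surf a b = vx * vy * vz - (b0 * (vx * s + a0) + a0 * (vy * B + b0) - a0 * b0)"
    unfolding surf_def ev1_decomp[of a] ev1_decomp[of b]
    by (simp add: d s_def B_def star ev1_pCons)
  define w where "w = u * v * ((a2 + a3 * vx) * (vx * vz - a0 * B) + vz * (a1 - 2 * s + t * vy * vz))"
  have "vy * w - b0 * (ev1 (star_poly (bar_poly a)) (sigma_y_x a b) + vx) =
      surf a b * (u * v * (a2 + a3 * vx))"
    unfolding E X S w_def s_def using inv by algebra
  then show ?thesis unfolding eq_on_def b0_def by (metis dvd_triv_left)
qed

lemma sigma_y_quotient_unique:
  assumes "a \<in> P3x" "b \<in> P3x" "eq_on a b (vy * w) r" "eq_on a b (vy * w') r"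
  shows "eq_on a b w w'"
proof -
  have "surf a b dvd vy * w - r - (vy * w' - r)"
    using assms(3,4) unfolding eq_on_def by (rule dvd_diff)
  also have "vy * w - r - (vy * w' - r) = vy * (w - w')"
    by (simp add: algebra_simps)
  finally obtain q where q: "vy * (w - w') = surf a b * q" ..
  have prime: "prime_elem (vy :: 'a poly3)"
    unfolding vy_def by (rule lift_prime_elem_poly)
      (auto simp: prime_elem_def dvd_iff_poly_eq_0[of 0, simplified])
  have nd: "\<not> vy dvd surf a b"
  proof
    assume "vy dvd surf a b"
    then have "[:0, 1:] dvd coeff (surf a b) 0"
      unfolding vy_def const_poly_dvd_iff by blast
    then have "poly (coeff (surf a b) 0) 0 = 0"
      by (simp add: dvd_iff_poly_eq_0[of 0, simplified])
    then have "poly (poly (surf a b) 0) 0 = 0"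
      by (simp add: poly_0_coeff_0)
    moreover have "poly (poly (ev1 p vx) 0) 0 = p" for p :: "'a poly"
      by (induction p) (simp_all add: ev1_pCons cst_def vx_def)
    moreover have "poly (poly (ev1 b vy) 0) 0 = [:coeff b 0:]"
      by (subst ev1_decomp) (simp add: cst_def vy_def)
    ultimately have "smult (coeff b 0) a = 0"
      by (simp add: surf_def) (simp add: cst_def vx_def vy_def vz_def mult_ac)
    then show False using P3xD[OF assms(1)] P3xD[OF assms(2)] by auto
  qed
  have "vy dvd surf a b * q" using q by (metis dvd_triv_left)
  then have "vy dvd q" using prime nd by (simp add: prime_elem_dvd_mult_iff)
  then obtain q' where "q = vy * q'" ..
  with q have "vy * (w - w') = vy * (surf a b * q')" by (simp add: mult_ac)
  then have "w - w' = surf a b * q'" using prime by (simp add: prime_elem_def)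
  then show ?thesis unfolding eq_on_def by simp
qed

definition generator ::
  "'a::idom poly \<Rightarrow> 'a poly \<Rightarrow> 'a poly \<Rightarrow> 'a poly \<Rightarrow> 'a pmap \<Rightarrow> bool" where
  "generator a b c d \<phi> \<longleftrightarrow> linear_iso a b c d \<phi> \<or>
     (c = bar_poly a \<and> d = b \<and> \<phi> = sigma_y a b) \<or>
     (c = a \<and> d = bar_poly b \<and> \<phi> = sigma_x a b)"

text \<open>Finite compositions of generators between surfaces of the family, considered up to equality of
  morphisms.\<close>

inductive generated ::
  "'a::idom poly \<Rightarrow> 'a poly \<Rightarrow> 'a poly \<Rightarrow> 'a poly \<Rightarrow> 'a pmap \<Rightarrow> bool" where
  generated_id:
    "a \<in> P3x \<Longrightarrow> b \<in> P3x \<Longrightarrow> pmap_eq_on a b \<chi> id_pmap \<Longrightarrow> generated a b a b \<chi>"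
| generated_step:
    "generated a b c d \<phi> \<Longrightarrow> e \<in> P3x \<Longrightarrow> f \<in> P3x \<Longrightarrow> generator c d e f \<psi> \<Longrightarrow>
     pmap_eq_on a b \<chi> (comp_pmap \<psi> \<phi>) \<Longrightarrow> generated a b e f \<chi>"

end

theory Submission
  imports Defs "HOL-Library.Product_Lexorder" "HOL-Library.Product_Plus"
begin

text \<open>Embed the coordinate ring of \<open>S\<^sub>a\<^sub>,\<^sub>b\<close> into Laurent series through the torus
  \<open>xy \<noteq> 0\<close>, where the total degree in \<open>x, y\<close> is the pole order along the boundary cubic. The
  bracket with \<open>{x, y} = xy\<close> preserves the coordinate ring. If \<open>X, Y\<close> are the pullbacks of the
  coordinates under an isomorphism \<open>S\<^sub>a\<^sub>,\<^sub>b \<rightarrow> S\<^sub>c\<^sub>,\<^sub>d\<close>, the exchange relations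
  \<open>X X' = const \<cdot> d(Y)\<close> and \<open>Y Y' = const \<cdot> c(X)\<close> force \<open>{X, Y} = u X Y\<close> with a nonzero constant
  \<open>u\<close>. Comparing leading terms, \<open>u\<close> is the determinant of the leading exponents of \<open>X\<close> and \<open>Y\<close>,
  so the degree is a monomial valuation in \<open>X\<close> and \<open>Y\<close>, with weights \<open>p, q \<ge> 1\<close>.

  If \<open>2p > 3q\<close>, then \<open>\<sigma>\<^sub>y\<close> replaces \<open>p\<close> by \<open>3q - p < p\<close>; symmetrically for \<open>\<sigma>\<^sub>x\<close>. Otherwise
  Laurent expansion in \<open>X, Y\<close> shows that nonconstant regular functions have degree at least
  \<open>min p q\<close>, and since \<open>x\<close> has degree 1, \<open>p = q = 1\<close>. Then \<open>X\<close> and \<open>Y\<close> are affine-linear in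
  \<open>x, y, z\<close>, and \<open>{X, Y} = u X Y\<close> makes the isomorphism linear in the sense of type (1).\<close>


section \<open>Evaluation homomorphisms\<close>

text \<open>Why the bracket is log-canonical: bracketing \<open>X X' = const d(Y)\<close> with
  \<open>Y\<close> kills the right side and leaves \<open>X' {X, Y} = - X {X', Y}\<close>. Since
  \<open>X'\<close> is not a zero divisor modulo \<open>X\<close>, \<open>X\<close> divides
  \<open>{X, Y}\<close>; by symmetry so does \<open>Y\<close>. The two are coprime because
  \<open>X X'\<close> is a unit constant modulo \<open>Y\<close>. The bracket creates no additional
  poles, so the quotient has degree at most 0.

  The characteristic is harmless: \<open>u\<close> is the determinant of exponents read in R, so a
  nonzero \<open>u\<close> makes it a nonzero integer. Distinct monomials in \<open>X, Y\<close>
  then have distinct leading exponents and cannot cancel.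

  Origin of the degree bound: a pole of order i along \<open>X = 0\<close> carries the factor
  \<open>d(Y)^i\<close> of degree 3i, which pushes a corner of the Newton polygon of the numerator
  far out; likewise for \<open>Y = 0\<close>. The corners suffice exactly when both 2p <= 3q and 2q
  <= 3p. The complementary condition 3q < 2p says 3q - p < p, so the exchange lowers p + q, the
  measure of the induction.

  That the scaling factors are units of R is settled only at the end, from the constant coefficient
  of the surface equation.\<close>

definition is_hom :: "('r::comm_ring_1 \<Rightarrow> 'l::comm_ring_1) \<Rightarrow> bool" where
  "is_hom h \<longleftrightarrow> h 1 = 1 \<and> (\<forall>x y. h (x + y) = h x + h y) \<and> (\<forall>x y. h (x * y) = h x * h y)"

definition eval_along :: "('r::comm_ring_1 \<Rightarrow> 'l::comm_ring_1) \<Rightarrow> 'l \<Rightarrow> 'r poly \<Rightarrow> 'l" where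
  "eval_along h t p = poly (map_poly h p) t"

lemma is_homD:
  assumes "is_hom h"
  shows "h 1 = 1" "h (x + y) = h x + h y" "h (x * y) = h x * h y" "h 0 = 0"
    "h (- x) = - h x" "h (x - y) = h x - h y" "h (x ^ n) = h x ^ n"
proof -
  show a: "h 1 = 1" "h (x + y) = h x + h y" "h (x * y) = h x * h y" for x y
    using assms by (auto simp: is_hom_def)
  show z: "h 0 = 0" using a(2)[of 0 0] by simp
  show m: "h (- x) = - h x" for x
    using a(2)[of x "- x"] z by (simp add: eq_neg_iff_add_eq_0 add.commute)
  show "h (x - y) = h x - h y"
    using a(2)[of x "- y"] m by simp
  show "h (x ^ n) = h x ^ n" by (induction n) (simp_all add: a)
qed

lemma is_hom_dvd: "is_hom h \<Longrightarrow> x dvd y \<Longrightarrow> h x dvd h y"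
  by (auto simp: is_homD elim!: dvdE)

lemma is_hom_comp: "is_hom g \<Longrightarrow> is_hom h \<Longrightarrow> is_hom (\<lambda>x. g (h x))"
  by (auto simp: is_hom_def)

lemma is_hom_cst: "is_hom cst"
  by (simp add: is_hom_def cst_simps)

lemma is_hom_const_poly: "is_hom (\<lambda>c. [:c:])"
  by (simp add: is_hom_def one_pCons)

lemma eval_along_pCons:
  "is_hom h \<Longrightarrow> eval_along h t (pCons c p) = h c + t * eval_along h t p"
  by (simp add: eval_along_def map_poly_pCons is_homD)

lemma eval_along_0 [simp]: "eval_along h t 0 = 0"
  by (simp add: eval_along_def)

lemma eval_along_const: "is_hom h \<Longrightarrow> eval_along h t [:c:] = h c"
  by (simp add: eval_along_pCons)

lemma eval_along_var: "is_hom h \<Longrightarrow> eval_along h t [:0, 1:] = t"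
  by (simp add: eval_along_pCons is_homD)

lemma is_hom_eval_along:
  assumes "is_hom h" shows "is_hom (eval_along h t)"
proof -
  have add: "eval_along h t (p + q) = eval_along h t p + eval_along h t q" for p q
    by (induction p arbitrary: q)
      (simp, case_tac q, simp add: eval_along_pCons[OF assms] is_homD[OF assms] algebra_simps)
  have smult: "eval_along h t (smult c p) = h c * eval_along h t p" for c p
    by (induction p) (simp_all add: eval_along_pCons[OF assms] is_homD[OF assms] algebra_simps)
  have "eval_along h t (p * q) = eval_along h t p * eval_along h t q" for p q
    by (induction p)
      (simp_all add: eval_along_pCons[OF assms] is_homD[OF assms] add smult algebra_simps)
  with add show ?thesis
    using assms by (simp add: is_hom_def one_pCons eval_along_const)
qed

lemma hom_eval_along:
  assumes "is_hom g" "is_hom h"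
  shows "g (eval_along h t p) = eval_along (\<lambda>c. g (h c)) (g t) p"
  by (induction p)
    (simp_all add: eval_along_pCons assms is_hom_comp is_homD[OF assms(1)])

definition eval3 :: "('r::idom \<Rightarrow> 'l::idom) \<Rightarrow> 'l \<Rightarrow> 'l \<Rightarrow> 'l \<Rightarrow> 'r poly3 \<Rightarrow> 'l" where
  "eval3 h X Y Z = eval_along (eval_along (eval_along h X) Y) Z"

lemma is_hom_eval3: "is_hom h \<Longrightarrow> is_hom (eval3 h X Y Z)"
  by (simp add: eval3_def is_hom_eval_along)

lemma eval3_simps:
  assumes "is_hom h"
  shows "eval3 h X Y Z (cst c) = h c" "eval3 h X Y Z vx = X"
    "eval3 h X Y Z vy = Y" "eval3 h X Y Z vz = Z"
  unfolding eval3_def cst_def vx_def vy_def vz_def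
  by (simp_all add: eval_along_const eval_along_var assms is_hom_eval_along)

lemma ev1_eval_along: "ev1 p t = eval_along cst t p"
  by (simp add: ev1_def eval_along_def)

lemma hom_ev1: "is_hom g \<Longrightarrow> g (ev1 p t) = eval_along (\<lambda>c. g (cst c)) (g t) p"
  by (simp add: ev1_eval_along hom_eval_along is_hom_cst)

lemma eval3_ev1: "is_hom h \<Longrightarrow> eval3 h X Y Z (ev1 p t) = eval_along h (eval3 h X Y Z t) p"
  by (simp add: hom_ev1 is_hom_eval3 eval3_simps)

lemma subst3_eval3: "subst3 (X, Y, Z) = eval3 cst X Y Z"
  by (rule ext) (simp add: eval3_def eval_along_def[abs_def] ev1_def[abs_def])

declare subst3.simps [simp del]

lemma poly3_decomp:
  "pCons g (f::'a::idom poly3) = [:g:] + vz * f"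
  "[:pCons p (g::'a poly poly):] = [:[:p:]:] + vy * [:g:]"
  "[:[:pCons c (p::'a poly):]:] = cst c + vx * [:[:p:]:]"
  by (simp_all add: vz_def vy_def vx_def cst_def)

lemma poly3_induct [case_names const x y z add mult]:
  fixes P :: "'a::idom poly3 \<Rightarrow> bool"
  assumes c: "\<And>c. P (cst c)" and x: "P vx" and y: "P vy" and z: "P vz"
    and add: "\<And>f g. P f \<Longrightarrow> P g \<Longrightarrow> P (f + g)" and mult: "\<And>f g. P f \<Longrightarrow> P g \<Longrightarrow> P (f * g)"
  shows "P f"
proof -
  have zero: "P 0" using c[of 0] by (simp add: cst_simps)
  have 1: "P [:[:p:]:]" for p
  proof (induction p)
    case (pCons c p)
    have "P (cst c + vx * [:[:p:]:])" by (rule add[OF c mult[OF x pCons(2)]])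
    then show ?case by (subst poly3_decomp(3))
  qed (simp add: zero)
  have 2: "P [:g:]" for g
  proof (induction g)
    case (pCons p g)
    have "P ([:[:p:]:] + vy * [:g:])" by (rule add[OF 1 mult[OF y pCons(2)]])
    then show ?case by (subst poly3_decomp(2))
  qed (simp add: zero)
  show ?thesis
  proof (induction f)
    case (pCons g f)
    have "P ([:g:] + vz * f)" by (rule add[OF 2 mult[OF z pCons(2)]])
    then show ?case by (subst poly3_decomp(1))
  qed (simp add: zero)
qed

lemma hom_eval3:
  assumes "is_hom g" "is_hom h"
  shows "g (eval3 h X Y Z f) = eval3 (\<lambda>c. g (h c)) (g X) (g Y) (g Z) f"
  by (induction f rule: poly3_induct)
    (simp_all add: assms is_homD is_hom_comp is_hom_eval3 eval3_simps)

lemma eval3_subst3: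
  assumes "is_hom h"
  shows "eval3 h X Y Z (subst3 (U, V, W) f) =
    eval3 h (eval3 h X Y Z U) (eval3 h X Y Z V) (eval3 h X Y Z W) f"
  by (simp add: subst3_eval3 hom_eval3 assms is_hom_eval3 is_hom_cst eval3_simps)

lemma eval3_id: "eval3 cst vx vy vz f = f"
  by (induction f rule: poly3_induct) (simp_all add: eval3_simps is_hom_cst is_homD is_hom_eval3)

lemma eval3_surf:
  assumes "is_hom h"
  shows "eval3 h X Y Z (surf a b) = X * Y * Z - (h (coeff b 0) * eval_along h X a
    + h (coeff a 0) * eval_along h Y b - h (coeff a 0) * h (coeff b 0))"
  using is_homD[OF is_hom_eval3[OF assms, of X Y Z]]
  by (simp add: surf_def eval3_simps assms eval3_ev1)

lemma star_poly_pCons: "a = pCons (coeff a 0) (star_poly a)"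
  using star_poly_decomp[of a] by (simp add: add.commute)

lemma eval_along_star:
  "is_hom h \<Longrightarrow> eval_along h t a = h (coeff a 0) + t * eval_along h t (star_poly a)"
  by (subst star_poly_pCons[of a]) (simp add: eval_along_pCons)

section \<open>Morphisms of surfaces\<close>

lemma eq_on_refl [simp]: "eq_on a b f f"
  by (simp add: eq_on_def)

lemma eq_on_sym: "eq_on a b f g \<Longrightarrow> eq_on a b g f"
  unfolding eq_on_def by (metis dvd_minus_iff minus_diff_eq)

lemma eq_on_trans: "eq_on a b f g \<Longrightarrow> eq_on a b g k \<Longrightarrow> eq_on a b f k"
  unfolding eq_on_def using dvd_add[of "surf a b" "f - g" "g - k"] by simp

lemma eq_on_add: "eq_on a b f f' \<Longrightarrow> eq_on a b g g' \<Longrightarrow> eq_on a b (f + g) (f' + g')"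
  unfolding eq_on_def using dvd_add[of "surf a b" "f - f'" "g - g'"] by (simp add: algebra_simps)

lemma eq_on_mult:
  assumes "eq_on a b f f'" "eq_on a b g g'" shows "eq_on a b (f * g) (f' * g')"
proof -
  have "f * g - f' * g' = (f - f') * g + f' * (g - g')" by (simp add: algebra_simps)
  then show ?thesis using assms unfolding eq_on_def by simp
qed

lemma pmap_eq_on_refl [simp]: "pmap_eq_on a b \<phi> \<phi>"
  by (cases \<phi>) simp

lemma pmap_eq_on_sym: "pmap_eq_on a b \<phi> \<psi> \<Longrightarrow> pmap_eq_on a b \<psi> \<phi>"
  by (cases \<phi>; cases \<psi>) (auto intro: eq_on_sym)

lemma pmap_eq_on_trans: "pmap_eq_on a b \<phi> \<psi> \<Longrightarrow> pmap_eq_on a b \<psi> \<chi> \<Longrightarrow> pmap_eq_on a b \<phi> \<chi>"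
  by (cases \<phi>; cases \<psi>; cases \<chi>) (auto intro: eq_on_trans)

lemma is_hom_subst3: "is_hom (subst3 \<phi>)"
  by (cases \<phi>) (simp add: subst3_eval3 is_hom_eval3 is_hom_cst)

lemma subst3_cong:
  assumes "pmap_eq_on a b \<phi> \<psi>" shows "eq_on a b (subst3 \<phi> f) (subst3 \<psi> f)"
proof -
  obtain X Y Z X' Y' Z' where p: "\<phi> = (X, Y, Z)" "\<psi> = (X', Y', Z')"
    by (cases \<phi>; cases \<psi>) auto
  then have e: "eq_on a b X X'" "eq_on a b Y Y'" "eq_on a b Z Z'" using assms by auto
  show ?thesis unfolding p subst3_eval3
    by (induction f rule: poly3_induct)
      (auto simp: eval3_simps is_hom_cst e is_homD is_hom_eval3 intro: eq_on_add eq_on_mult)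
qed

lemma subst3_comp: "subst3 \<phi> (subst3 \<psi> f) = subst3 (comp_pmap \<psi> \<phi>) f"
  by (cases \<phi>; cases \<psi>)
    (simp only: comp_pmap.simps subst3_eval3 hom_eval3 is_hom_eval3 is_hom_cst eval3_simps)

lemma comp_pmap_assoc: "comp_pmap \<phi> (comp_pmap \<psi> \<chi>) = comp_pmap (comp_pmap \<phi> \<psi>) \<chi>"
  by (cases \<phi>) (simp add: subst3_comp)

lemma subst3_id [simp]: "subst3 id_pmap f = f"
  unfolding id_pmap_def subst3_eval3 by (rule eval3_id)

lemma comp_pmap_id [simp]: "comp_pmap \<phi> id_pmap = \<phi>" "comp_pmap id_pmap \<phi> = \<phi>"
  by (cases \<phi>, simp) (cases \<phi>, simp add: id_pmap_def)

lemma comp_pmap_cong_right: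
  "pmap_eq_on a b \<phi> \<phi>' \<Longrightarrow> pmap_eq_on a b (comp_pmap \<psi> \<phi>) (comp_pmap \<psi> \<phi>')"
  by (cases \<psi>) (auto intro: subst3_cong)

lemma morphism_subst3_eq_on:
  assumes "surf_morphism a b c d \<phi>" "eq_on c d f g"
  shows "eq_on a b (subst3 \<phi> f) (subst3 \<phi> g)"
proof -
  have "surf a b dvd subst3 \<phi> (surf c d)"
    using assms(1) by (simp add: surf_morphism_def eq_on_def)
  also have "\<dots> dvd subst3 \<phi> (f - g)"
    using assms(2) by (simp add: eq_on_def is_hom_dvd[OF is_hom_subst3])
  finally show ?thesis by (simp add: eq_on_def is_homD[OF is_hom_subst3])
qed

lemma comp_pmap_cong_left:
  assumes "surf_morphism a b c d \<phi>" "pmap_eq_on c d \<psi> \<psi>'"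
  shows "pmap_eq_on a b (comp_pmap \<psi> \<phi>) (comp_pmap \<psi>' \<phi>)"
  using assms(2) morphism_subst3_eq_on[OF assms(1)]
  by (cases \<psi>; cases \<psi>') auto

lemma morphism_comp:
  assumes "surf_morphism a b c d \<phi>" "surf_morphism c d e f \<psi>"
  shows "surf_morphism a b e f (comp_pmap \<psi> \<phi>)"
  using morphism_subst3_eq_on[OF assms(1), of "subst3 \<psi> (surf e f)" 0] assms(2)
  by (simp add: surf_morphism_def subst3_comp is_homD[OF is_hom_subst3])

lemma morphism_cong:
  assumes "surf_morphism a b c d \<phi>" "pmap_eq_on a b \<phi> \<psi>"
  shows "surf_morphism a b c d \<psi>"
  using assms subst3_cong[OF assms(2)] eq_on_trans eq_on_sym
  unfolding surf_morphism_def by blast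

lemma surf_iso_cong:
  assumes "surf_iso a b c d \<phi>" "pmap_eq_on a b \<phi> \<psi>"
  shows "surf_iso a b c d \<psi>"
proof -
  from assms(1) obtain \<rho> where m: "surf_morphism a b c d \<phi>" and r: "surf_morphism c d a b \<rho>"
      "pmap_eq_on a b (comp_pmap \<rho> \<phi>) id_pmap" "pmap_eq_on c d (comp_pmap \<phi> \<rho>) id_pmap"
    unfolding surf_iso_def by blast
  have "pmap_eq_on a b (comp_pmap \<rho> \<psi>) id_pmap"
    using comp_pmap_cong_right[OF pmap_eq_on_sym[OF assms(2)]] r(2) pmap_eq_on_trans by blast
  moreover have "pmap_eq_on c d (comp_pmap \<psi> \<rho>) id_pmap"
    using comp_pmap_cong_left[OF r(1) pmap_eq_on_sym[OF assms(2)]] r(3) pmap_eq_on_trans by blast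
  ultimately show ?thesis
    using morphism_cong[OF m assms(2)] r(1) unfolding surf_iso_def by blast
qed

lemma surf_iso_id: "surf_iso a b a b id_pmap"
proof -
  have "surf_morphism a b a b id_pmap" by (simp add: surf_morphism_def eq_on_def)
  then show ?thesis unfolding surf_iso_def by (metis comp_pmap_id(1) pmap_eq_on_refl)
qed

lemma surf_iso_comp:
  assumes "surf_iso a b c d \<phi>" "surf_iso c d e f \<psi>"
  shows "surf_iso a b e f (comp_pmap \<psi> \<phi>)"
proof -
  from assms(1) obtain \<phi>' where p: "surf_morphism a b c d \<phi>" "surf_morphism c d a b \<phi>'"
      "pmap_eq_on a b (comp_pmap \<phi>' \<phi>) id_pmap" "pmap_eq_on c d (comp_pmap \<phi> \<phi>') id_pmap"
    unfolding surf_iso_def by blast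
  from assms(2) obtain \<psi>' where q: "surf_morphism c d e f \<psi>" "surf_morphism e f c d \<psi>'"
      "pmap_eq_on c d (comp_pmap \<psi>' \<psi>) id_pmap" "pmap_eq_on e f (comp_pmap \<psi> \<psi>') id_pmap"
    unfolding surf_iso_def by blast
  have *: "pmap_eq_on x y (comp_pmap (comp_pmap \<beta> \<alpha>) (comp_pmap \<alpha>' \<beta>')) id_pmap"
    if "surf_morphism x y z w \<beta>'" "pmap_eq_on z w (comp_pmap \<alpha> \<alpha>') id_pmap"
      "pmap_eq_on x y (comp_pmap \<beta> \<beta>') id_pmap" for x y z w :: "'a poly" and \<alpha> \<beta> \<alpha>' \<beta>'
  proof -
    have "pmap_eq_on x y (comp_pmap (comp_pmap \<alpha> \<alpha>') \<beta>') \<beta>'"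
      using comp_pmap_cong_left[OF that(1,2)] by simp
    from comp_pmap_cong_right[OF this] that(3) show ?thesis
      by (metis comp_pmap_assoc pmap_eq_on_trans)
  qed
  show ?thesis unfolding surf_iso_def
    using morphism_comp[OF p(1) q(1)] morphism_comp[OF q(2) p(2)]
      *[OF p(1) q(3) p(3)] *[OF q(2) p(4) q(4)] by blast
qed

unbundle fps_syntax

section \<open>Iterated Laurent series\<close>

text \<open>The lexicographic valuation. On the Laurent polynomials in the elements \<open>lx\<close> and \<open>ly\<close> below, it
  is the total degree (with opposite sign), refined by the exponent of \<open>lx\<close>.\<close>

definition val :: "'a::zero fls fls \<Rightarrow> int \<times> int" where
  "val f = (fls_subdegree f, fls_subdegree (f $$ fls_subdegree f))"

definition lcoeff :: "'a::zero fls fls \<Rightarrow> int \<times> int \<Rightarrow> 'a" where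
  "lcoeff f v = f $$ fst v $$ snd v"

text \<open>Unlike \<open>val\<close>, which takes the default \<open>(0, 0)\<close> at 0, this
  bound holds for 0 at every index. Products and brackets can thus be estimated before they are
  known to be nonzero.\<close>

definition val_ge :: "'a::zero fls fls \<Rightarrow> int \<times> int \<Rightarrow> bool" where
  "val_ge f v \<longleftrightarrow> (\<forall>w < v. lcoeff f w = 0)"

lemma val_ge_iff:
  "val_ge f v \<longleftrightarrow> (\<forall>k < fst v. f $$ k = 0) \<and> (\<forall>k < snd v. f $$ fst v $$ k = 0)"
  by (auto simp: val_ge_def lcoeff_def less_prod_def' fls_eq_iff)

lemma val_ge_val: "val_ge f (val f)"
  by (simp add: val_ge_iff val_def fls_eq0_below_subdegree)

lemma lcoeff_val: "f \<noteq> 0 \<Longrightarrow> lcoeff f (val f) \<noteq> 0"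
  by (simp add: lcoeff_def val_def)

lemma val_eqI: "val_ge f v \<Longrightarrow> lcoeff f v \<noteq> 0 \<Longrightarrow> val f = v"
proof -
  assume *: "val_ge f v" "lcoeff f v \<noteq> 0"
  then have s: "fls_subdegree f = fst v"
    by (intro fls_subdegree_eqI) (auto simp: val_ge_iff lcoeff_def)
  moreover have "fls_subdegree (f $$ fst v) = snd v"
    using * by (intro fls_subdegree_eqI) (auto simp: val_ge_iff lcoeff_def)
  ultimately show ?thesis by (simp add: val_def prod_eq_iff)
qed

lemma val_ge_imp_le: "f \<noteq> 0 \<Longrightarrow> val_ge f v \<Longrightarrow> v \<le> val f"
  using lcoeff_val[of f] unfolding val_ge_def not_less[symmetric] by blast

lemma val_le: "lcoeff f v \<noteq> 0 \<Longrightarrow> val f \<le> v"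
  using val_ge_val[of f] unfolding val_ge_def not_less[symmetric] by blast

lemma fls_mult_nth_lower:
  fixes f g :: "'a::idom fls"
  assumes "\<forall>k<n. f $$ k = 0" "\<forall>k<m. g $$ k = 0"
  shows "(f * g) $$ (n + m) = f $$ n * g $$ m" "k < n + m \<Longrightarrow> (f * g) $$ k = 0"
proof -
  have "(f * g) $$ (n + m) = f $$ n * g $$ m \<and> (k < n + m \<longrightarrow> (f * g) $$ k = 0)"
  proof (cases "f = 0 \<or> g = 0")
    case False
    then have s: "n \<le> fls_subdegree f" "m \<le> fls_subdegree g"
      using assms by (auto intro: fls_subdegree_geI)
    then consider "n = fls_subdegree f" "m = fls_subdegree g" | "n < fls_subdegree f"
      | "m < fls_subdegree g" by force
    then show ?thesis using s
      by cases (auto simp: fls_times_nth_eq0 fls_times_base)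
  qed auto
  then show "(f * g) $$ (n + m) = f $$ n * g $$ m" "k < n + m \<Longrightarrow> (f * g) $$ k = 0" by auto
qed

lemma lcoeff_mult:
  fixes f g :: "'a::idom fls fls"
  assumes "val_ge f v" "val_ge g w"
  shows "lcoeff (f * g) (v + w) = lcoeff f v * lcoeff g w" "val_ge (f * g) (v + w)"
proof -
  have *: "\<forall>k<fst v. f $$ k = 0" "\<forall>k<fst w. g $$ k = 0"
    "\<forall>k<snd v. f $$ fst v $$ k = 0" "\<forall>k<snd w. g $$ fst w $$ k = 0"
    using assms by (simp_all add: val_ge_iff)
  show "lcoeff (f * g) (v + w) = lcoeff f v * lcoeff g w" "val_ge (f * g) (v + w)"
    using fls_mult_nth_lower[OF *(1,2)] fls_mult_nth_lower[OF *(3,4)]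
    by (auto simp: lcoeff_def val_ge_iff)
qed

lemma val_mult:
  fixes f g :: "'a::idom fls fls"
  assumes "f \<noteq> 0" "g \<noteq> 0" shows "val (f * g) = val f + val g"
  using lcoeff_mult[OF val_ge_val val_ge_val, of f g] lcoeff_val assms
  by (intro val_eqI) auto

lemma lcoeff_add: "lcoeff (f + g) v = lcoeff f v + lcoeff g v"
  by (simp add: lcoeff_def)

lemma lcoeff_diff: "lcoeff (f - g) v = lcoeff f v - lcoeff (g::'a::ab_group_add fls fls) v"
  by (simp add: lcoeff_def)

lemma val_ge_less: "val_ge f v \<Longrightarrow> w < v \<Longrightarrow> lcoeff f w = 0"
  unfolding val_ge_def by blast

lemma val_add_less:
  fixes f g :: "'a::idom fls fls"
  assumes "f \<noteq> 0" "val f < val g"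
  shows "f + g \<noteq> 0" "val (f + g) = val f"
proof -
  have c: "lcoeff (f + g) (val f) \<noteq> 0"
    using val_ge_less[OF val_ge_val assms(2)] lcoeff_val[OF assms(1)] by (simp add: lcoeff_add)
  then show "f + g \<noteq> 0" by (metis lcoeff_def fls_zero_nth)
  have "val_ge (f + g) (val f)"
    using val_ge_less[OF val_ge_val[of f]] val_ge_less[OF val_ge_val[of g]] assms(2)
    unfolding val_ge_def lcoeff_add by (metis add_0 order.strict_trans)
  from this c show "val (f + g) = val f" by (rule val_eqI)
qed

text \<open>No two terms share a valuation, so the term of least valuation survives in every partial
  sum.\<close>

lemma val_sum:
  fixes T :: "'i \<Rightarrow> 'a::idom fls fls"
  assumes "finite I" "I \<noteq> {}" "\<And>k. k \<in> I \<Longrightarrow> T k \<noteq> 0" "inj_on (\<lambda>k. val (T k)) I"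
  shows "sum T I \<noteq> 0 \<and> (\<exists>k\<in>I. val (sum T I) = val (T k)) \<and> (\<forall>l\<in>I. val (sum T I) \<le> val (T l))"
  using assms
proof (induction I rule: finite_ne_induct)
  case (insert k I)
  then have IH: "sum T I \<noteq> 0" "\<exists>l\<in>I. val (sum T I) = val (T l)"
    "\<forall>l\<in>I. val (sum T I) \<le> val (T l)" by auto
  have ne: "val (T k) \<noteq> val (sum T I)"
    using IH(2) insert.hyps insert.prems(2) by (auto simp: inj_on_def)
  have s: "sum T (insert k I) = T k + sum T I" using insert.hyps by simp
  show ?case
  proof (cases "val (T k) < val (sum T I)")
    case True
    note * = val_add_less[OF insert.prems(1) True, simplified]
    have "val (T k) \<le> val (T l)" if "l \<in> I" for l
      using True IH(3) that by (meson less_imp_le order.trans)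
    then show ?thesis unfolding s using * by auto
  next
    case False
    then have l: "val (sum T I) < val (T k)" using ne by auto
    note * = val_add_less[OF IH(1) l]
    show ?thesis unfolding s add.commute[of "T k"] using * IH l by auto
  qed
qed auto

definition ldeg :: "'a::zero fls fls \<Rightarrow> int" where
  "ldeg f = - fls_subdegree f"

lemma ldeg_val: "ldeg f = - fst (val f)"
  by (simp add: ldeg_def val_def)

lemma ldeg_mult: "f \<noteq> 0 \<Longrightarrow> g \<noteq> 0 \<Longrightarrow> ldeg (f * g) = ldeg f + ldeg (g::'a::idom fls fls)"
  by (simp add: ldeg_def)

lemma ldeg_power: "f \<noteq> 0 \<Longrightarrow> ldeg (f ^ n) = int n * ldeg (f::'a::idom fls fls)"
  by (induction n) (simp_all add: ldeg_mult algebra_simps, simp add: ldeg_def)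

text \<open>Since \<open>ldeg 0 = 0\<close> by default, \<open>0 \<le> n\<close> covers the case of
  a vanishing sum.\<close>

lemma ldeg_add_le:
  fixes f g :: "'a::idom fls fls"
  assumes "ldeg f \<le> n" "ldeg g \<le> n" "0 \<le> n" shows "ldeg (f + g) \<le> n"
proof (cases "f + g = 0")
  case False
  then show ?thesis using assms fls_plus_subdegree[OF False] by (auto simp: ldeg_def min_def split: if_splits)
qed (use assms in \<open>simp add: ldeg_def\<close>)

lemma ldeg_uminus: "ldeg (- f) = ldeg (f::'a::idom fls fls)"
  by (simp add: ldeg_def)

lemma ldeg_add_less: "ldeg g < ldeg f \<Longrightarrow> f \<noteq> 0 \<Longrightarrow> ldeg (f + g) = ldeg (f::'a::idom fls fls)"
  by (simp add: ldeg_def fls_subdegree_add_eq1)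

definition lconst :: "'a::idom \<Rightarrow> 'a fls fls" where
  "lconst c = fls_const (fls_const c)"

text \<open>The outer variable stands for 1/y and the inner one for x/y. A monomial of exponents i,
  j in x, y therefore has valuation \<open>(- (i + j), i)\<close>.\<close>

definition lx :: "'a::idom fls fls" where
  "lx = fls_const fls_X * fls_X_inv"

definition ly :: "'a::idom fls fls" where
  "ly = fls_X_inv"

lemma is_hom_lconst: "is_hom lconst"
  by (simp add: is_hom_def lconst_def fls_plus_const)

lemmas lconst_simps = is_homD[OF is_hom_lconst]

lemma lconst_eq_0 [simp]: "lconst c = 0 \<longleftrightarrow> c = 0"
  by (simp add: lconst_def)

lemma val_lconst: "val (lconst c) = 0"
  by (simp add: val_def lconst_def zero_prod_def)

lemma ldeg_lconst [simp]: "ldeg (lconst c) = 0"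
  by (simp add: ldeg_def lconst_def)

lemma lcoeff_lconst_mult: "lcoeff (lconst c * f) v = c * lcoeff f v"
  by (simp add: lcoeff_def lconst_def)

lemma fls_X_inv_times_fls_X: "fls_X_inv * fls_X = (1 :: 'a::idom fls)"
  by (rule fls_eqI) (simp add: fls_X_inv_times_conv_shift(1))

lemma lx_inverse: "lx * (fls_const fls_X_inv * fls_X) = 1"
  and ly_inverse: "ly * fls_X = 1"
proof -
  note * = fls_X_inv_times_fls_X
  show "ly * fls_X = 1" by (simp add: ly_def *)
  have "lx * (fls_const fls_X_inv * fls_X) =
      fls_const (fls_X * fls_X_inv) * (fls_X_inv * fls_X)"
    by (simp add: lx_def algebra_simps flip: fls_const_mult_const)
  then show "lx * (fls_const fls_X_inv * fls_X) = (1 :: 'a fls fls)"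
    by (simp add: * mult.commute[of fls_X])
qed

lemma lx_ly_nonzero [simp]: "lx \<noteq> 0" "ly \<noteq> 0"
  using lx_inverse ly_inverse by (metis mult_zero_left zero_neq_one)+

lemma lx_nth: "lx $$ n = (if n = - 1 then fls_X else 0)"
  by (simp add: lx_def)

lemma val_lx: "val lx = (- 1, 1)" and val_ly: "val ly = (- 1, 0)"
  by (auto intro!: val_eqI simp: val_ge_iff lcoeff_def lx_nth ly_def)

lemma ldeg_lx: "ldeg lx = 1" and ldeg_ly: "ldeg ly = 1"
  by (simp_all add: ldeg_val val_lx val_ly)

section \<open>Derivations and the Poisson bracket\<close>

definition is_derivation :: "('a::idom fls fls \<Rightarrow> 'a fls fls) \<Rightarrow> bool" where
  "is_derivation D \<longleftrightarrow> (\<forall>f g. D (f + g) = D f + D g) \<and> (\<forall>f g. D (f * g) = D f * g + f * D g)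
     \<and> (\<forall>c. D (lconst c) = 0)"

lemma is_derivationD:
  assumes "is_derivation D"
  shows "D (f + g) = D f + D g" "D (f * g) = D f * g + f * D g" "D (lconst c) = 0"
    "D 0 = 0" "D (f - g) = D f - D g"
proof -
  show *: "D (f + g) = D f + D g" "D (f * g) = D f * g + f * D g" "D (lconst c) = 0" for f g c
    using assms by (auto simp: is_derivation_def)
  show "D 0 = 0" using *(3)[of 0] by (simp add: lconst_simps)
  show "D (f - g) = D f - D g" using *(1)[of "f - g" g] by (simp add: algebra_simps)
qed

definition theta_in :: "'a::idom fls \<Rightarrow> 'a fls" where
  "theta_in f = fls_X * fls_deriv f"

text \<open>\<open>theta1\<close> and \<open>theta2\<close> are the Euler operators of the outer and
  the inner variable. They multiply each coefficient by an exponent, so they never lower a valuation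
  bound.\<close>

definition theta1 :: "'a::idom fls fls \<Rightarrow> 'a fls fls" where
  "theta1 f = fls_X * fls_deriv f"

definition theta2 :: "'a::idom fls fls \<Rightarrow> 'a fls fls" where
  "theta2 f = Abs_fls (\<lambda>n. theta_in (f $$ n))"

lemma theta_in_nth: "theta_in f $$ n = of_int n * f $$ n"
  by (simp add: theta_in_def fls_X_times_conv_shift)

lemma theta1_nth: "theta1 f $$ n = of_int n * f $$ n"
  by (simp add: theta1_def fls_X_times_conv_shift)

lemma theta2_nth: "theta2 f $$ n = theta_in (f $$ n)"
proof -
  obtain N where "\<forall>n<N. f $$ n = 0" by (rule fls_nth_vanishes_belowE)
  then show ?thesis unfolding theta2_def
    by (intro nth_Abs_fls_lower_bound[of N]) (simp add: theta_in_def)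
qed

lemma theta_in_mult: "theta_in (f * g) = theta_in f * g + f * theta_in g"
  by (simp add: theta_in_def algebra_simps)

lemma theta_in_sum: "theta_in (sum f I) = (\<Sum>i\<in>I. theta_in (f i))"
  by (simp add: theta_in_def fls_deriv_sum sum_distrib_left)

text \<open>The range of summation depends only on chosen lower bounds, not on the true subdegrees.
  The same range then serves a series and its Euler derivative, whose leading coefficient may
  vanish.\<close>

lemma fls_mult_nth_wide:
  fixes f g :: "'a::idom fls"
  assumes "\<forall>k<n. f $$ k = 0" "\<forall>k<m. g $$ k = 0"
  shows "(f * g) $$ k = (\<Sum>i=n..k - m. f $$ i * g $$ (k - i))"
proof (cases "f = 0 \<or> g = 0")
  case False
  then have s: "n \<le> fls_subdegree f" "m \<le> fls_subdegree g"
    using assms by (auto intro: fls_subdegree_geI)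
  have "(\<Sum>i=n..k - m. f $$ i * g $$ (k - i)) =
      (\<Sum>i=fls_subdegree f..k - fls_subdegree g. f $$ i * g $$ (k - i))"
    using s by (intro sum.mono_neutral_right) (auto simp: not_le intro!: fls_eq0_below_subdegree)
  then show ?thesis by (simp only: fls_times_nth(2))
qed auto

lemma theta2_mult: "theta2 (f * g) = theta2 f * g + f * theta2 g"
proof (rule fls_eqI)
  fix k
  obtain n where n: "\<forall>k<n. f $$ k = 0" by (rule fls_nth_vanishes_belowE)
  obtain m where m: "\<forall>k<m. g $$ k = 0" by (rule fls_nth_vanishes_belowE)
  have n': "\<forall>k<n. theta2 f $$ k = 0" and m': "\<forall>k<m. theta2 g $$ k = 0"
    using n m by (simp_all add: theta2_nth theta_in_def)
  show "theta2 (f * g) $$ k = (theta2 f * g + f * theta2 g) $$ k"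
    by (simp add: theta2_nth fls_mult_nth_wide[OF n m] fls_mult_nth_wide[OF n' m]
        fls_mult_nth_wide[OF n m'] theta_in_sum theta_in_mult sum.distrib)
qed

lemma is_derivation_theta1: "is_derivation theta1"
  by (simp add: is_derivation_def theta1_def lconst_def algebra_simps)

lemma is_derivation_theta2: "is_derivation theta2"
proof -
  have "theta2 (f + g) = theta2 f + theta2 g" for f g :: "'a fls fls"
    by (rule fls_eqI) (simp add: theta2_nth theta_in_def algebra_simps)
  moreover have "theta2 (lconst c) = 0" for c :: 'a
    by (rule fls_eqI) (simp add: theta2_nth theta_in_def lconst_def)
  ultimately show ?thesis by (simp add: is_derivation_def theta2_mult)
qed

text \<open>A Jacobian in logarithmic coordinates, normalized by
  \<open>bracket_lx_ly\<close>.\<close>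

definition bracket :: "'a::idom fls fls \<Rightarrow> 'a fls fls \<Rightarrow> 'a fls fls" where
  "bracket f g = theta1 f * theta2 g - theta2 f * theta1 g"

lemma is_derivation_bracket: "is_derivation (bracket f)" "is_derivation (\<lambda>f. bracket f g)"
  by (simp_all add: is_derivation_def bracket_def is_derivationD[OF is_derivation_theta1]
      is_derivationD[OF is_derivation_theta2] algebra_simps)

lemma bracket_self [simp]: "bracket f f = 0"
  by (simp add: bracket_def mult.commute)

lemma bracket_swap: "bracket g f = - bracket f g"
  by (simp add: bracket_def mult.commute)

lemma bracket_lx_ly: "bracket lx ly = (lx * ly :: 'a::idom fls fls)"
proof -
  have "theta1 lx = - (lx :: 'a fls fls)" "theta2 lx = (lx :: 'a fls fls)"
    "theta1 ly = - (ly :: 'a fls fls)" "theta2 ly = (0 :: 'a fls fls)"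
    by (rule fls_eqI; simp add: theta1_nth theta2_nth lx_nth ly_def theta_in_def)+
  then show ?thesis by (simp add: bracket_def)
qed

lemma
  assumes "val_ge f v"
  shows lcoeff_theta1: "lcoeff (theta1 f) v = of_int (fst v) * lcoeff f v"
    and lcoeff_theta2: "lcoeff (theta2 f) v = of_int (snd v) * lcoeff f v"
    and val_ge_theta1: "val_ge (theta1 f) v" and val_ge_theta2: "val_ge (theta2 f) v"
proof -
  have 1: "lcoeff (theta1 f) v = of_int (fst v) * lcoeff f v" for v
    by (simp add: lcoeff_def theta1_nth fls_of_int)
  have 2: "lcoeff (theta2 f) v = of_int (snd v) * lcoeff f v" for v
    by (simp add: lcoeff_def theta2_nth theta_in_nth)
  show "lcoeff (theta1 f) v = of_int (fst v) * lcoeff f v" by (rule 1)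
  show "lcoeff (theta2 f) v = of_int (snd v) * lcoeff f v" by (rule 2)
  show "val_ge (theta1 f) v" "val_ge (theta2 f) v"
    using assms by (simp_all add: val_ge_def 1 2)
qed

text \<open>The leading coefficient of a bracket is a determinant of valuations. Where the bracket is
  log-canonical, this determinant is thus nonzero, even modulo the characteristic.\<close>

lemma bracket_log_canonical_det:
  fixes X Y :: "'a::idom fls fls"
  assumes "X \<noteq> 0" "Y \<noteq> 0" "bracket X Y = lconst u * (X * Y)" "u \<noteq> 0"
  shows "fst (val X) * snd (val Y) \<noteq> snd (val X) * fst (val Y)"
proof
  assume eq: "fst (val X) * snd (val Y) = snd (val X) * fst (val Y)"
  define c where "c = lcoeff X (val X) * lcoeff Y (val Y)"
  have "c \<noteq> 0" using assms by (simp add: c_def lcoeff_val)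
  have "u * c = lcoeff (lconst u * (X * Y)) (val X + val Y)"
    by (simp add: lcoeff_lconst_mult c_def lcoeff_mult val_ge_val)
  also have "\<dots> = lcoeff (bracket X Y) (val X + val Y)" by (simp add: assms(3))
  also have "\<dots> = of_int (fst (val X) * snd (val Y) - snd (val X) * fst (val Y)) * c"
    by (simp add: bracket_def lcoeff_diff lcoeff_mult lcoeff_theta1 lcoeff_theta2 val_ge_val
        val_ge_theta1 val_ge_theta2 c_def) (simp add: algebra_simps)
  also have "\<dots> = 0" using eq by simp
  finally show False using \<open>c \<noteq> 0\<close> assms(4) by simp
qed

lemma derivation_eval_along:
  assumes "is_derivation D"
  shows "D (eval_along lconst t p) = eval_along lconst t (pderiv p) * D t"
  by (induction p)
    (simp_all add: eval_along_pCons is_hom_lconst is_derivationD[OF assms] pderiv_pCons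
      is_homD[OF is_hom_eval_along[OF is_hom_lconst]] lconst_simps algebra_simps)

lemma derivation_zero_range:
  assumes "is_derivation D" "D X = 0" "D Y = 0" "D Z = 0" "f \<in> range (eval3 lconst X Y Z)"
  shows "D f = 0"
proof -
  have "D (eval3 lconst X Y Z g) = 0" for g
    by (induction g rule: poly3_induct)
      (simp_all add: assms eval3_simps is_hom_lconst is_homD[OF is_hom_eval3[OF is_hom_lconst]]
        is_derivationD[OF assms(1)])
  then show ?thesis using assms(5) by auto
qed

section \<open>Laurent expansions in a chart\<close>

lemma eval_along_sum:
  assumes "is_hom h"
  shows "eval_along h t p = (\<Sum>i\<le>degree p. h (coeff p i) * t ^ i)"
proof (induction p)
  case (pCons c p)
  show ?case
  proof (cases "p = 0")
    case True
    then show ?thesis by (simp add: eval_along_const assms)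
  next
    case False
    then have "(\<Sum>i\<le>degree (pCons c p). h (coeff (pCons c p) i) * t ^ i) =
        h c + t * (\<Sum>i\<le>degree p. h (coeff p i) * t ^ i)"
      by (simp add: sum.atMost_Suc_shift sum_distrib_left mult_ac del: sum.atMost_Suc)
    then show ?thesis by (simp add: eval_along_pCons assms pCons)
  qed
qed (simp add: is_homD[OF assms])

text \<open>The outer polynomial variable goes to \<open>X\<close> and the inner one to
  \<open>Y\<close>, the opposite nesting to \<open>poly3\<close>: \<open>coeff G i\<close> is a
  polynomial in \<open>Y\<close>, the row at the i-th power of \<open>X\<close>.\<close>

definition eval2 :: "'a::idom fls fls \<Rightarrow> 'a fls fls \<Rightarrow> 'a poly poly \<Rightarrow> 'a fls fls" where
  "eval2 X Y = eval_along (eval_along lconst Y) X"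

lemma is_hom_eval2: "is_hom (eval2 X Y)"
  by (simp add: eval2_def is_hom_eval_along is_hom_lconst)

lemmas eval2_simps = is_homD[OF is_hom_eval2]

lemma eval2_const: "eval2 X Y [:p:] = eval_along lconst Y p"
  by (simp add: eval2_def eval_along_const is_hom_eval_along is_hom_lconst)

lemma eval2_const_const: "eval2 X Y [:[:c:]:] = lconst c"
  by (simp add: eval2_const eval_along_const is_hom_lconst)

lemma eval2_pCons: "eval2 X Y (pCons p G) = eval_along lconst Y p + X * eval2 X Y G"
  by (simp add: eval2_def eval_along_pCons is_hom_eval_along is_hom_lconst)

definition expts :: "'a::zero poly poly \<Rightarrow> (nat \<times> nat) set" where
  "expts G = {(i, j). coeff (coeff G i) j \<noteq> 0}"

lemma expts_bound: "expts G \<subseteq> (SIGMA i:{..degree G}. {..degree (coeff G i)})"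
  by (auto simp: expts_def le_degree) (metis coeff_0 le_degree)

lemma finite_expts: "finite (expts G)"
  by (rule finite_subset[OF expts_bound]) auto

lemma expts_nonempty: "G \<noteq> 0 \<Longrightarrow> expts G \<noteq> {}"
  by (auto simp: expts_def poly_eq_iff)

lemma eval2_sum:
  "eval2 X Y G = (\<Sum>(i, j)\<in>expts G. lconst (coeff (coeff G i) j) * X ^ i * Y ^ j)"
proof -
  have "eval2 X Y G = (\<Sum>i\<le>degree G. \<Sum>j\<le>degree (coeff G i). lconst (coeff (coeff G i) j) * X ^ i * Y ^ j)"
    by (simp add: eval2_def eval_along_sum is_hom_eval_along is_hom_lconst sum_distrib_right)
      (simp add: mult_ac)
  also have "\<dots> = (\<Sum>(i, j)\<in>(SIGMA i:{..degree G}. {..degree (coeff G i)}).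
      lconst (coeff (coeff G i) j) * X ^ i * Y ^ j)"
    by (simp add: sum.Sigma)
  also have "\<dots> = (\<Sum>(i, j)\<in>expts G. lconst (coeff (coeff G i) j) * X ^ i * Y ^ j)"
    by (rule sum.mono_neutral_right[OF _ expts_bound]) (auto simp: expts_def)
  finally show ?thesis .
qed

text \<open>The leading exponents are linearly independent over the integers, which separates the
  valuations of all monomials in \<open>X\<close> and \<open>Y\<close>.\<close>

definition independent :: "'a::idom fls fls \<Rightarrow> 'a fls fls \<Rightarrow> bool" where
  "independent X Y \<longleftrightarrow> X \<noteq> 0 \<and> Y \<noteq> 0 \<and> fst (val X) * snd (val Y) \<noteq> snd (val X) * fst (val Y)"

lemma val_power: "X \<noteq> 0 \<Longrightarrow> val (X ^ n) = (int n * fst (val X), int n * snd (val (X::'a::idom fls fls)))"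
proof (induction n)
  case 0
  then show ?case using val_lconst[of "1::'a"] by (simp add: lconst_simps zero_prod_def)
qed (simp add: val_mult algebra_simps plus_prod_def)

lemma val_monomial:
  fixes X Y :: "'a::idom fls fls"
  assumes "X \<noteq> 0" "Y \<noteq> 0" "c \<noteq> 0"
  shows "val (lconst c * X ^ i * Y ^ j) = (int i * fst (val X) + int j * fst (val Y),
    int i * snd (val X) + int j * snd (val Y))"
  using assms by (simp add: val_mult val_power val_lconst)

lemma val_eval2:
  assumes "independent X Y" "G \<noteq> 0"
  shows "eval2 X Y G \<noteq> 0"
    "\<exists>(i, j)\<in>expts G. val (eval2 X Y G) = (int i * fst (val X) + int j * fst (val Y),
      int i * snd (val X) + int j * snd (val Y))"
    "(i, j) \<in> expts G \<Longrightarrow> val (eval2 X Y G) \<le> (int i * fst (val X) + int j * fst (val Y),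
      int i * snd (val X) + int j * snd (val Y))"
proof -
  define T where "T = (\<lambda>(i, j). lconst (coeff (coeff G i) j) * X ^ i * Y ^ j)"
  have XY: "X \<noteq> 0" "Y \<noteq> 0" "fst (val X) * snd (val Y) \<noteq> snd (val X) * fst (val Y)"
    using assms(1) by (auto simp: independent_def)
  have v: "val (T (i, j)) = (int i * fst (val X) + int j * fst (val Y),
      int i * snd (val X) + int j * snd (val Y))" if "(i, j) \<in> expts G" for i j
    using that XY by (simp add: T_def expts_def val_monomial)
  have "inj_on (\<lambda>k. val (T k)) (expts G)"
  proof (rule inj_onI, clarify)
    fix i j k l assume *: "(i, j) \<in> expts G" "(k, l) \<in> expts G" "val (T (i, j)) = val (T (k, l))"
    obtain a b a' b' where ab: "val X = (a, b)" "val Y = (a', b')" by (metis surj_pair)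
    have "(int i - int k) * a + (int j - int l) * a' = 0" "(int i - int k) * b + (int j - int l) * b' = 0"
      using * v by (simp_all add: ab algebra_simps)
    \<comment> \<open>Cramer's rule: the nonzero determinant annihilates both differences of
      exponents.\<close>
    then have "(int i - int k) * (a * b' - b * a') = 0" "(int j - int l) * (a * b' - b * a') = 0"
      by algebra+
    then show "i = k \<and> j = l" using XY(3) by (simp add: ab)
  qed
  moreover have "T k \<noteq> 0" if "k \<in> expts G" for k
    using that XY by (auto simp: T_def expts_def)
  ultimately have *: "sum T (expts G) \<noteq> 0" "\<exists>k\<in>expts G. val (sum T (expts G)) = val (T k)"
    "\<forall>k\<in>expts G. val (sum T (expts G)) \<le> val (T k)"
    using val_sum[OF finite_expts expts_nonempty[OF assms(2)], of T] by blast+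
  have s: "eval2 X Y G = sum T (expts G)" by (simp add: eval2_sum T_def)
  show "eval2 X Y G \<noteq> 0" using * s by simp
  show "\<exists>(i, j)\<in>expts G. val (eval2 X Y G) = (int i * fst (val X) + int j * fst (val Y),
      int i * snd (val X) + int j * snd (val Y))"
    using *(2) s v by fastforce
  show "(i, j) \<in> expts G \<Longrightarrow> val (eval2 X Y G) \<le> (int i * fst (val X) + int j * fst (val Y),
      int i * snd (val X) + int j * snd (val Y))"
    using * s v by metis
qed

lemma eval2_inject: "independent X Y \<Longrightarrow> eval2 X Y G = eval2 X Y H \<longleftrightarrow> G = H"
  using val_eval2(1)[of X Y "G - H"] by (auto simp: eval2_simps)

lemma ldeg_eval2:
  assumes "independent X Y" "(i, j) \<in> expts G"
  shows "int i * ldeg X + int j * ldeg Y \<le> ldeg (eval2 X Y G)"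
proof -
  have "G \<noteq> 0" using assms(2) by (auto simp: expts_def)
  from val_eval2(3)[OF assms(1) this assms(2)]
  have "fst (val (eval2 X Y G)) \<le> int i * fst (val X) + int j * fst (val Y)"
    by (cases "val (eval2 X Y G)") auto
  then show ?thesis by (simp add: ldeg_val)
qed

lemma ldeg_eval_along:
  assumes "1 \<le> ldeg X" "p \<noteq> 0"
  shows "ldeg (eval_along lconst X p) = int (degree p) * ldeg X \<and> eval_along lconst X p \<noteq> 0"
  using assms(2)
proof (induction p)
  case (pCons c p)
  have X: "X \<noteq> 0" using assms by (auto simp: ldeg_def)
  show ?case
  proof (cases "p = 0")
    case True
    then show ?thesis using pCons by (simp add: eval_along_const is_hom_lconst)
  next
    case False
    define E where "E = eval_along lconst X p"
    have E: "ldeg E = int (degree p) * ldeg X" "E \<noteq> 0" using pCons False by (auto simp: E_def)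
    then have l: "ldeg (X * E) = int (degree (pCons c p)) * ldeg X" "X * E \<noteq> 0"
      using X False by (auto simp: ldeg_mult algebra_simps)
    moreover have g: "ldeg (lconst c) < ldeg (X * E)"
      using assms(1) l(1) False by (simp add: E(1) zero_less_mult_iff)
    ultimately have "ldeg (X * E + lconst c) = int (degree (pCons c p)) * ldeg X"
      by (simp add: ldeg_add_less)
    moreover have "X * E + lconst c \<noteq> 0"
    proof
      assume "X * E + lconst c = 0"
      then have "X * E = lconst (- c)" by (simp add: lconst_simps eq_neg_iff_add_eq_0)
      then show False using g by simp
    qed
    ultimately show ?thesis by (simp add: eval_along_pCons is_hom_lconst E_def add.commute)
  qed
qed simp

section \<open>Divisibility of the low rows and columns of a Laurent numerator\<close>

definition col :: "'a::zero poly poly \<Rightarrow> nat \<Rightarrow> 'a poly" where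
  "col G j = map_poly (\<lambda>p. coeff p j) G"

lemma coeff_col [simp]: "coeff (col G j) i = coeff (coeff G i) j"
  by (simp add: col_def coeff_map_poly)

text \<open>The two properties shared by rows (\<open>coeff\<close>) and columns
  (\<open>col\<close>), so that poles along x = 0 and y = 0 are treated by one argument.\<close>

definition convolutive :: "('a::idom poly poly \<Rightarrow> nat \<Rightarrow> 'a poly) \<Rightarrow> bool" where
  "convolutive r \<longleftrightarrow> (\<forall>G H m. r (G + H) m = r G m + r H m) \<and>
     (\<forall>G H m. r (G * H) m = (\<Sum>i\<le>m. r G i * r H (m - i)))"

lemma convolutive_coeff: "convolutive coeff"
  by (simp add: convolutive_def coeff_mult)

lemma convolutive_col: "convolutive col"
proof -
  have "col (G * H) m = (\<Sum>i\<le>m. col G i * col H (m - i))" for G H :: "'a poly poly" and m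
  proof (rule poly_eqI)
    fix k
    have "coeff (\<Sum>i\<le>m. col G i * col H (m - i)) k =
        (\<Sum>i\<le>m. \<Sum>l\<le>k. coeff (coeff G l) i * coeff (coeff H (k - l)) (m - i))"
      by (simp add: coeff_sum coeff_mult)
    also have "\<dots> = (\<Sum>l\<le>k. \<Sum>i\<le>m. coeff (coeff G l) i * coeff (coeff H (k - l)) (m - i))"
      by (rule sum.swap)
    also have "\<dots> = coeff (col (G * H) m) k"
      by (simp add: coeff_sum coeff_mult)
    finally show "coeff (col (G * H) m) k = coeff (\<Sum>i\<le>m. col G i * col H (m - i)) k" by simp
  qed
  then show ?thesis by (auto simp: convolutive_def intro!: poly_eqI)
qed

text \<open>After division by the n-th power of xy, row m is a pole of order n - m, which must carry
  that power of \<open>D\<close>. Truncated subtraction makes the condition void for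
  \<open>m \<ge> n\<close>.\<close>

definition low_dvd :: "('a::idom poly poly \<Rightarrow> nat \<Rightarrow> 'a poly) \<Rightarrow> 'a poly \<Rightarrow> nat \<Rightarrow> 'a poly poly \<Rightarrow> bool" where
  "low_dvd r D n G \<longleftrightarrow> (\<forall>m. D ^ (n - m) dvd r G m)"

lemma low_dvd_0: "low_dvd r D 0 G"
  by (simp add: low_dvd_def)

lemma low_dvd_1: "D dvd r G 0 \<Longrightarrow> low_dvd r D 1 G"
  unfolding low_dvd_def by (intro allI, case_tac m) auto

lemma low_dvd_add:
  "convolutive r \<Longrightarrow> low_dvd r D n G \<Longrightarrow> low_dvd r D n H \<Longrightarrow> low_dvd r D n (G + H)"
  by (simp add: low_dvd_def convolutive_def)

lemma low_dvd_mult: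
  assumes "convolutive r" "low_dvd r D n G" "low_dvd r D k H"
  shows "low_dvd r D (n + k) (G * H)"
proof -
  have "D ^ (n + k - m) dvd r G i * r H (m - i)" if "i \<le> m" for m i
  proof -
    have "D ^ (n + k - m) dvd D ^ ((n - i) + (k - (m - i)))"
      using that by (intro le_imp_power_dvd) auto
    also have "\<dots> dvd r G i * r H (m - i)"
      using assms unfolding low_dvd_def power_add by (intro mult_dvd_mono) auto
    finally show ?thesis .
  qed
  then show ?thesis using assms(1) by (auto simp: low_dvd_def convolutive_def intro!: dvd_sum)
qed

lemma low_dvd_power:
  "convolutive r \<Longrightarrow> low_dvd r D 1 G \<Longrightarrow> low_dvd r D n (G ^ n)"
  by (induction n) (auto simp: low_dvd_0 dest: low_dvd_mult[of r D 1 G])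

text \<open>The numerator of z as a fraction with denominator xy on the surface.\<close>

definition surf_num :: "'a::idom poly \<Rightarrow> 'a poly \<Rightarrow> 'a poly poly" where
  "surf_num c d = smult [:coeff d 0:] (map_poly (\<lambda>c. [:c:]) c) + [:smult (coeff c 0) d:]
    - [:[:coeff c 0 * coeff d 0:]:]"

lemma surf_num_coeff_0: "coeff (surf_num c d) 0 = smult (coeff c 0) d"
  by (simp add: surf_num_def coeff_map_poly mult.commute)

lemma surf_num_col_0: "col (surf_num c d) 0 = smult (coeff d 0) c"
  by (rule poly_eqI) (simp add: surf_num_def coeff_map_poly coeff_pCons split: nat.split)

lemma eval2_surf_num:
  "eval2 X Y (surf_num c d) = lconst (coeff d 0) * eval_along lconst X c
    + lconst (coeff c 0) * eval_along lconst Y d - lconst (coeff c 0) * lconst (coeff d 0)"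
proof -
  have l: "eval2 X Y (map_poly (\<lambda>c. [:c:]) c) = eval_along lconst X c"
    by (induction c) (simp_all add: map_poly_pCons eval2_pCons eval2_simps eval_along_pCons
        is_hom_lconst eval_along_const)
  have s: "eval2 X Y (smult [:a:] G) = lconst a * eval2 X Y G" for a G
    using eval2_simps(3)[of X Y "[:[:a:]:]" G] unfolding eval2_const_const by simp
  have s': "eval_along lconst Y (smult a p) = lconst a * eval_along lconst Y p" for a p
    using is_homD(3)[OF is_hom_eval_along[OF is_hom_lconst], of Y "[:a:]" p]
    unfolding eval_along_const[OF is_hom_lconst] by simp
  show ?thesis
    by (simp only: surf_num_def eval2_simps(2,6) s l eval2_const s' eval_along_const[OF is_hom_lconst]
        lconst_simps(3))
qed

definition mono_xy :: "'a::idom poly poly" where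
  "mono_xy = [:0, [:0, 1:]:]"

lemma mono_xy_power: "mono_xy ^ l = monom (monom 1 l) l"
proof -
  have "(mono_xy :: 'a poly poly) = monom (monom 1 1) 1" by (simp add: mono_xy_def monom_altdef)
  from arg_cong[OF this, of "\<lambda>p. p ^ l"] show ?thesis unfolding monom_power by simp
qed

lemma eval2_mono_xy: "eval2 X Y mono_xy = X * Y"
  by (simp add: mono_xy_def eval2_pCons eval_along_var is_hom_lconst eval2_simps)

definition on_surf :: "'a::idom poly \<Rightarrow> 'a poly \<Rightarrow> 'a fls fls \<Rightarrow> 'a fls fls \<Rightarrow> 'a fls fls \<Rightarrow> bool" where
  "on_surf c d X Y Z \<longleftrightarrow> X * Y * Z = lconst (coeff d 0) * eval_along lconst X c
    + lconst (coeff c 0) * eval_along lconst Y d - lconst (coeff c 0) * lconst (coeff d 0)"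

text \<open>Poles of a regular function of order \<open>i\<close> along \<open>x = 0\<close> have leading coefficients divisible by
  the \<open>i\<close>-th power of \<open>d(y)\<close>, as \<open>z\<close> equals \<open>c\<^sub>0 d(y)/(xy)\<close> plus a regular term; likewise along
  \<open>y = 0\<close>.\<close>

definition laurent_rep :: "'a::idom poly \<Rightarrow> 'a poly \<Rightarrow> 'a fls fls \<Rightarrow> 'a fls fls \<Rightarrow>
    nat \<Rightarrow> 'a poly poly \<Rightarrow> 'a fls fls \<Rightarrow> bool" where
  "laurent_rep c d X Y n G f \<longleftrightarrow> (X * Y) ^ n * f = eval2 X Y G \<and>
     low_dvd coeff d n G \<and> low_dvd col c n G"

lemma laurent_rep_0: "laurent_rep c d X Y 0 G (eval2 X Y G)"
  by (simp add: laurent_rep_def low_dvd_0)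

lemma laurent_rep_add:
  "laurent_rep c d X Y n G f \<Longrightarrow> laurent_rep c d X Y n H g \<Longrightarrow> laurent_rep c d X Y n (G + H) (f + g)"
  by (simp add: laurent_rep_def eval2_simps distrib_left low_dvd_add convolutive_coeff convolutive_col)

lemma laurent_rep_mult:
  "laurent_rep c d X Y n G f \<Longrightarrow> laurent_rep c d X Y k H g \<Longrightarrow>
    laurent_rep c d X Y (n + k) (G * H) (f * g)"
proof -
  have "(X * Y) ^ (n + k) * (f * g) = ((X * Y) ^ n * f) * ((X * Y) ^ k * g)"
    by (simp add: power_add mult_ac)
  then show "laurent_rep c d X Y n G f \<Longrightarrow> laurent_rep c d X Y k H g \<Longrightarrow>
      laurent_rep c d X Y (n + k) (G * H) (f * g)"
    by (simp add: laurent_rep_def eval2_simps low_dvd_mult convolutive_coeff convolutive_col)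
qed

text \<open>Multiplying by this representation of 1 raises the exponent of the denominator, which
  brings two functions to a common denominator.\<close>

lemma laurent_rep_1: "laurent_rep c d X Y n (mono_xy ^ n) 1"
  by (auto simp: laurent_rep_def eval2_simps eval2_mono_xy intro!: low_dvd_power low_dvd_1
      convolutive_coeff convolutive_col) (simp_all add: mono_xy_def col_def map_poly_pCons)

lemma laurent_rep_z: "on_surf c d X Y Z \<Longrightarrow> laurent_rep c d X Y 1 (surf_num c d) Z"
  by (auto simp: laurent_rep_def on_surf_def eval2_surf_num surf_num_coeff_0 surf_num_col_0
      dvd_smult intro!: low_dvd_1[unfolded One_nat_def])

lemma laurent_rep_exists:
  assumes "on_surf c d X Y Z" "f \<in> range (eval3 lconst X Y Z)"
  shows "\<exists>n G. laurent_rep c d X Y n G f"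
proof -
  note s = eval3_simps[OF is_hom_lconst] is_homD[OF is_hom_eval3[OF is_hom_lconst]]
  have "\<exists>n G. laurent_rep c d X Y n G (eval3 lconst X Y Z g)" for g
  proof (induction g rule: poly3_induct)
    case (const e)
    then show ?case unfolding s using laurent_rep_0 eval2_const_const by metis
  next
    case x
    have "eval2 X Y [:0, 1:] = X"
      by (simp add: eval2_pCons is_homD[OF is_hom_eval_along[OF is_hom_lconst]] eval2_simps)
    then show ?case unfolding s using laurent_rep_0 by metis
  next
    case y
    have "eval2 X Y [:[:0, 1:]:] = Y" by (simp add: eval2_const eval_along_var is_hom_lconst)
    then show ?case unfolding s using laurent_rep_0 by metis
  next
    case z
    then show ?case unfolding s using laurent_rep_z[OF assms(1)] by blast
  next
    case (add f g)
    then obtain n G k H where r: "laurent_rep c d X Y n G (eval3 lconst X Y Z f)"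
      "laurent_rep c d X Y k H (eval3 lconst X Y Z g)" by blast
    then show ?case unfolding s
      using laurent_rep_add[OF laurent_rep_mult[OF r(1) laurent_rep_1[of c d X Y k]]
          laurent_rep_mult[OF laurent_rep_1[of c d X Y n] r(2)]] by auto
  next
    case (mult f g)
    then show ?case unfolding s using laurent_rep_mult by blast
  qed
  then show ?thesis using assms(2) by auto
qed

text \<open>The nonzero constant term keeps \<open>D\<close> from contributing zeros at 0, so the
  factor \<open>D ^ k\<close> and the m-fold zero of \<open>R\<close> contribute to its degree
  independently.\<close>

lemma degree_ge_of_power_dvd:
  fixes D R :: "'a::idom poly"
  assumes "coeff D 0 \<noteq> 0" "R \<noteq> 0" "D ^ k dvd R" "\<And>j. j < m \<Longrightarrow> coeff R j = 0"
  shows "k * degree D + m \<le> degree R"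
proof -
  obtain h where h: "R = D ^ k * h" using assms(3) by (elim dvdE)
  have nz: "D \<noteq> 0" "h \<noteq> 0" using assms(1,2) h by auto
  have "[:- 0, 1:] ^ m dvd R"
    using assms(4) monom_1_dvd_iff'[of m R] by (simp add: monom_altdef)
  then have "m \<le> order 0 R" using assms(2) order_divides[of 0 m R] by blast
  also have "order 0 R = order 0 (D ^ k) + order 0 h" using assms(2) h by (simp add: order_mult)
  also have "order 0 (D ^ k) = 0"
    using assms(1) by (intro order_0I) (simp flip: poly_0_coeff_0)
  also have "order 0 h \<le> degree h" using nz by (intro order_degree)
  finally show ?thesis using nz by (simp add: h degree_mult_eq degree_power_eq)
qed

section \<open>Lower bounds for degrees\<close>

text \<open>The exponents \<open>n - l\<close> and \<open>n - m\<close> are the pole orders along \<open>x = 0\<close> and \<open>y = 0\<close>.\<close>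

lemma laurent_rep_corner:
  fixes f :: "'a::idom fls fls"
  assumes cd: "c \<in> P3x" "d \<in> P3x" and ind: "independent X Y" and f: "f \<noteq> 0"
    and rep: "laurent_rep c d X Y n G f" and pos: "0 \<le> ldeg X" "0 \<le> ldeg Y"
  shows "\<exists>l m. (\<forall>i j. (i, j) \<in> expts G \<longrightarrow> l \<le> i \<and> m \<le> j) \<and>
    coeff G l \<noteq> 0 \<and> d ^ (n - l) dvd coeff G l \<and>
    int l * ldeg X + (3 * int (n - l) + int m) * ldeg Y \<le> ldeg f + int n * (ldeg X + ldeg Y) \<and>
    (3 * int (n - m) + int l) * ldeg X + int m * ldeg Y \<le> ldeg f + int n * (ldeg X + ldeg Y)"
proof -
  have XY: "X \<noteq> 0" "Y \<noteq> 0" using ind by (auto simp: independent_def)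
  have e: "(X * Y) ^ n * f = eval2 X Y G" and low: "low_dvd coeff d n G" "low_dvd col c n G"
    using rep by (auto simp: laurent_rep_def)
  then have "eval2 X Y G \<noteq> 0" using f XY by auto
  then have ne: "expts G \<noteq> {}" by (auto simp: eval2_sum)
  have deg: "int i * ldeg X + int j * ldeg Y \<le> ldeg f + int n * (ldeg X + ldeg Y)"
    if "(i, j) \<in> expts G" for i j
  proof -
    have "ldeg ((X * Y) ^ n * f) = int n * (ldeg X + ldeg Y) + ldeg f"
      using XY f by (simp add: ldeg_mult ldeg_power)
    then show ?thesis using ldeg_eval2[OF ind that] by (simp add: e)
  qed
  define l where "l = (LEAST l. coeff G l \<noteq> 0)"
  define m where "m = (LEAST m. col G m \<noteq> 0)"
  from ne obtain i0 j0 where ij: "(i0, j0) \<in> expts G" by auto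
  have nz: "coeff G i \<noteq> 0" "col G j \<noteq> 0" if "(i, j) \<in> expts G" for i j
    using that by (auto simp: expts_def poly_eq_iff)
  have lm: "coeff G l \<noteq> 0" "col G m \<noteq> 0"
    unfolding l_def m_def using LeastI[of "\<lambda>l. coeff G l \<noteq> 0"] LeastI[of "\<lambda>m. col G m \<noteq> 0"] nz[OF ij]
    by blast+
  have le: "l \<le> i \<and> m \<le> j" if "(i, j) \<in> expts G" for i j
    unfolding l_def m_def using nz[OF that] by (auto intro: Least_le)
  have dv: "d ^ (n - l) dvd coeff G l" "c ^ (n - m) dvd col G m"
    using low by (auto simp: low_dvd_def)
  have "coeff (coeff G l) j = 0" if "j < m" for j
    using le[of l j] that by (auto simp: expts_def)
  \<comment> \<open>The lowest row contains a power of the cubic \<open>d\<close> and starts no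
    earlier than column \<open>m\<close>, so it is long.\<close>
  then have "(n - l) * 3 + m \<le> degree (coeff G l)"
    using degree_ge_of_power_dvd[OF P3xD(4)[OF cd(2)] lm(1) dv(1), of m] P3xD(1)[OF cd(2)] by simp
  then have r: "3 * int (n - l) + int m \<le> int (degree (coeff G l))" by linarith
  have "coeff (col G m) j = 0" if "j < l" for j
    using le[of j m] that by (auto simp: expts_def)
  then have "(n - m) * 3 + l \<le> degree (col G m)"
    using degree_ge_of_power_dvd[OF P3xD(4)[OF cd(1)] lm(2) dv(2), of l] P3xD(1)[OF cd(1)] by simp
  then have s: "3 * int (n - m) + int l \<le> int (degree (col G m))" by linarith
  \<comment> \<open>The far ends of the lowest row and of the lowest column are the two corners;
    \<open>deg\<close> applies to them because monomials do not cancel.\<close>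
  have "(l, degree (coeff G l)) \<in> expts G" "(degree (col G m), m) \<in> expts G"
    using lm leading_coeff_neq_0[OF lm(2)] by (auto simp: expts_def)
  from this[THEN deg]
  have "int l * ldeg X + (3 * int (n - l) + int m) * ldeg Y \<le> ldeg f + int n * (ldeg X + ldeg Y)"
    "(3 * int (n - m) + int l) * ldeg X + int m * ldeg Y \<le> ldeg f + int n * (ldeg X + ldeg Y)"
    using mult_right_mono[OF r pos(2)] mult_right_mono[OF s pos(1)] by linarith+
  with le lm(1) dv(1) show ?thesis by blast
qed

text \<open>The four cases are: no pole, a pole along \<open>X = 0\<close> only, along
  \<open>Y = 0\<close> only, and along both. With p, q the degrees of \<open>X\<close>,
  \<open>Y\<close>, a single pole gives degree at least 3q - p or 3p - q, and 3q - p >= p, 3p - q >=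
  q by hypothesis.\<close>

lemma laurent_rep_ldeg_bound:
  fixes f :: "'a::idom fls fls"
  assumes "c \<in> P3x" "d \<in> P3x" "independent X Y" "laurent_rep c d X Y n G f"
    and pq: "1 \<le> ldeg X" "1 \<le> ldeg Y" "2 * ldeg X \<le> 3 * ldeg Y" "2 * ldeg Y \<le> 3 * ldeg X"
    and f: "f \<notin> range lconst"
  shows "min (ldeg X) (ldeg Y) \<le> ldeg f"
proof -
  have f0: "f \<noteq> 0" using f lconst_simps(4) by (metis rangeI)
  have XY: "X \<noteq> 0" "Y \<noteq> 0" using assms(3) by (auto simp: independent_def)
  have "0 \<le> ldeg X" "0 \<le> ldeg Y" using pq by auto
  then obtain l m where lm: "\<forall>i j. (i, j) \<in> expts G \<longrightarrow> l \<le> i \<and> m \<le> j"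
      "coeff G l \<noteq> 0" "d ^ (n - l) dvd coeff G l"
    and corner: "int l * ldeg X + (3 * int (n - l) + int m) * ldeg Y \<le> ldeg f + int n * (ldeg X + ldeg Y)"
      "(3 * int (n - m) + int l) * ldeg X + int m * ldeg Y \<le> ldeg f + int n * (ldeg X + ldeg Y)"
    using laurent_rep_corner[OF assms(1-3) f0 assms(4)] by blast
  define p q where "p = ldeg X" and "q = ldeg Y"
  note pq = pq[folded p_def q_def]
  note corner = corner[folded p_def q_def]
  have mono: "b \<le> a * b" if "1 \<le> a" "0 \<le> b" for a b :: int
    using mult_right_mono[OF that] by simp
  consider "n \<le> l" "n \<le> m" | "l < n" "n \<le> m" | "n \<le> l" "m < n" | "l < n" "m < n" by linarith
  then have "min p q \<le> ldeg f"
  proof cases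
    case 1
    \<comment> \<open>The exponent \<open>(n, n)\<close> of the numerator is the constant term of
      \<open>f\<close>, so a nonconstant \<open>f\<close> has another one.\<close>
    have "\<exists>(i, j) \<in> expts G. (i, j) \<noteq> (n, n)"
    proof (rule ccontr)
      assume "\<not> ?thesis"
      then have *: "expts G \<subseteq> {(n, n)}" by auto
      have "eval2 X Y G = lconst (coeff (coeff G n) n) * X ^ n * Y ^ n"
      proof (cases "expts G = {}")
        case True
        then have "G = 0" using expts_nonempty by blast
        then show ?thesis by (simp add: eval2_simps lconst_simps)
      next
        case False
        with * have "expts G = {(n, n)}" by blast
        then show ?thesis by (simp add: eval2_sum)
      qed
      then have "(X * Y) ^ n * f = (X * Y) ^ n * lconst (coeff (coeff G n) n)"
        using assms(4) by (simp add: laurent_rep_def power_mult_distrib mult_ac)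
      then have "f = lconst (coeff (coeff G n) n)" using XY by simp
      with f show False by blast
    qed
    then obtain i j where ij: "(i, j) \<in> expts G" "(i, j) \<noteq> (n, n)" by auto
    then have ge: "n \<le> i" "n \<le> j" using lm(1) 1 by (metis order.trans)+
    have "int i * p + int j * q \<le> ldeg f + int n * (p + q)"
    proof -
      have "ldeg ((X * Y) ^ n * f) = int n * (p + q) + ldeg f"
        using XY f0 by (simp add: ldeg_mult ldeg_power p_def q_def)
      then show ?thesis using ldeg_eval2[OF assms(3) ij(1)] assms(4)
        by (simp add: laurent_rep_def p_def q_def)
    qed
    then have *: "(int i - int n) * p + (int j - int n) * q \<le> ldeg f" by (simp add: algebra_simps)
    have "0 \<le> (int i - int n) * p" "0 \<le> (int j - int n) * q" using ge pq by auto
    moreover have "p \<le> (int i - int n) * p \<or> q \<le> (int j - int n) * q"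
      using ij(2) ge mono[of "int i - int n" p] mono[of "int j - int n" q] pq by auto
    ultimately show ?thesis using * by linarith
  next
    case 2
    define i j where "i = int n - int l" and "j = int m - int n"
    have "0 \<le> j * q" "3 * q - p \<le> i * (3 * q - p)"
      using 2 pq mono[of i "3 * q - p"] by (auto simp: i_def j_def)
    moreover have eqs: "int l = int n - i" "int (n - l) = i" "int m = int n + j"
      using 2 by (auto simp: i_def j_def)
    have "i * (3 * q - p) + j * q \<le> ldeg f"
      using corner(1) unfolding eqs by (simp add: algebra_simps)
    ultimately show ?thesis using pq by linarith
  next
    case 3
    define i j where "i = int l - int n" and "j = int n - int m"
    have "0 \<le> i * p" "3 * p - q \<le> j * (3 * p - q)"
      using 3 pq mono[of j "3 * p - q"] by (auto simp: i_def j_def)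
    moreover have eqs: "int l = int n + i" "int (n - m) = j" "int m = int n - j"
      using 3 by (auto simp: i_def j_def)
    have "j * (3 * p - q) + i * p \<le> ldeg f"
      using corner(2) unfolding eqs by (simp add: algebra_simps)
    ultimately show ?thesis using pq by linarith
  next
    case 4
    define i j where "i = int n - int l" and "j = int n - int m"
    have "3 * q - 2 * p \<le> i * (3 * q - 2 * p)" "3 * p - 2 * q \<le> j * (3 * p - 2 * q)"
      using 4 pq mono[of i "3 * q - 2 * p"] mono[of j "3 * p - 2 * q"] by (auto simp: i_def j_def)
    moreover have eqs: "int l = int n - i" "int (n - m) = j" "int (n - l) = i" "int m = int n - j"
      using 4 by (auto simp: i_def j_def)
    \<comment> \<open>Neither corner suffices alone, but their sum does: both factors in parentheses
      are nonnegative, \<open>i\<close> and \<open>j\<close> are at least 1, and the left side is at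
      least p + q.\<close>
    have "i * (3 * q - 2 * p) + j * (3 * p - 2 * q) \<le> 2 * ldeg f"
      using corner unfolding eqs by (simp add: algebra_simps)
    ultimately show ?thesis using pq by linarith
  qed
  then show ?thesis by (simp add: p_def q_def)
qed

lemma ldeg_on_surf_z:
  assumes "c \<in> P3x" "d \<in> P3x" "on_surf c d X Y Z" "ldeg X = 1" "ldeg Y = 1"
  shows "ldeg Z \<le> 1"
proof (cases "Z = 0")
  case False
  have XY: "X \<noteq> 0" "Y \<noteq> 0" using assms by (auto simp: ldeg_def)
  have E: "ldeg (lconst e * eval_along lconst t p) \<le> 3" if "p \<in> P3x" "ldeg t = 1" for e p t
  proof -
    have "p \<noteq> 0" using P3xD(5)[OF that(1)] by auto
    then show ?thesis using ldeg_eval_along[of t p] that P3xD(1)[OF that(1)]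
      by (cases "e = 0") (auto simp: ldeg_mult lconst_simps, simp add: ldeg_def)
  qed
  have "ldeg (lconst (coeff d 0) * eval_along lconst X c + (lconst (coeff c 0) * eval_along lconst Y d
      + lconst (- (coeff c 0 * coeff d 0)))) \<le> 3"
    using E assms by (intro ldeg_add_le) auto
  then have "ldeg (X * Y * Z) \<le> 3"
    using assms(3) by (simp add: on_surf_def lconst_simps add_diff_eq)
  then show ?thesis using XY False assms by (simp add: ldeg_mult)
qed (simp add: ldeg_def)

text \<open>Degree at most 1 allows only simple poles along \<open>X = 0\<close> and
  \<open>Y = 0\<close>, and these must occur together. Their leading part is then proportional to
  that of \<open>Z\<close>, so subtracting a multiple of \<open>Z\<close> leaves an affine
  polynomial in \<open>X\<close> and \<open>Y\<close>.\<close>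

lemma ldeg_one_span:
  fixes f :: "'a::idom fls fls"
  assumes cd: "c \<in> P3x" "d \<in> P3x" and ind: "independent X Y" and surf: "on_surf c d X Y Z"
    and pq: "ldeg X = 1" "ldeg Y = 1" and f: "f \<in> range (eval3 lconst X Y Z)" "ldeg f \<le> 1"
  shows "\<exists>\<alpha> \<beta> \<gamma> \<delta>. f = lconst \<alpha> * X + lconst \<beta> * Y + lconst \<gamma> * Z + lconst \<delta>"
proof -
  have XY: "X \<noteq> 0" "Y \<noteq> 0" using ind by (auto simp: independent_def)
  \<comment> \<open>Without a pole along \<open>X = 0\<close> the second corner excludes one along
    \<open>Y = 0\<close>, and the degree leaves only the exponents of 1, \<open>X\<close> and
    \<open>Y\<close>, shifted by \<open>(n, n)\<close>.\<close>
  have polynomial_case: "\<exists>\<alpha> \<beta> \<delta>. g = lconst \<alpha> * X + lconst \<beta> * Y + lconst \<delta>"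
    if rep: "laurent_rep c d X Y n G g" and g: "ldeg g \<le> 1" and l: "\<And>i. i < n \<Longrightarrow> coeff G i = 0"
    for n G and g :: "'a fls fls"
  proof (cases "g = 0")
    case True
    then show ?thesis by (intro exI[of _ 0]) (simp add: lconst_simps)
  next
    case False
    have "0 \<le> ldeg X" "0 \<le> ldeg Y" using pq by auto
    then obtain l m where lm: "\<forall>i j. (i, j) \<in> expts G \<longrightarrow> l \<le> i \<and> m \<le> j"
      "coeff G l \<noteq> 0" "d ^ (n - l) dvd coeff G l"
      "int l * ldeg X + (3 * int (n - l) + int m) * ldeg Y \<le> ldeg g + int n * (ldeg X + ldeg Y)"
      "(3 * int (n - m) + int l) * ldeg X + int m * ldeg Y \<le> ldeg g + int n * (ldeg X + ldeg Y)"
      using laurent_rep_corner[OF cd ind False rep] by blast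
    note lm = lm[unfolded pq]
    have "n \<le> l" using l lm(2) not_less by blast
    moreover have "n \<le> m"
    proof (rule ccontr)
      assume "\<not> n \<le> m"
      then have e: "int (n - m) = int n - int m" by auto
      have *: "int n \<le> int l" "int m + 1 \<le> int n" using \<open>n \<le> l\<close> \<open>\<not> n \<le> m\<close> by auto
      have "3 * (int n - int m) + int l + int m \<le> ldeg g + 2 * int n"
        using lm(5) e by simp
      with * g show False by simp
    qed
    moreover have "int i + int j \<le> 1 + 2 * int n" if "(i, j) \<in> expts G" for i j
    proof -
      have "ldeg ((X * Y) ^ n * g) = int n * 2 + ldeg g"
        using XY False pq by (simp add: ldeg_mult ldeg_power)
      then show ?thesis using ldeg_eval2[OF ind that] rep g pq
        by (simp add: laurent_rep_def)
    qed
    ultimately have sub: "expts G \<subseteq> {(n, n), (Suc n, n), (n, Suc n)}"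
      using lm(1) by (fastforce simp: le_Suc_eq)
    have "eval2 X Y G = (\<Sum>(i, j)\<in>{(n, n), (Suc n, n), (n, Suc n)}.
        lconst (coeff (coeff G i) j) * X ^ i * Y ^ j)"
      unfolding eval2_sum
      by (rule sum.mono_neutral_left[OF _ sub]) (auto simp: expts_def lconst_simps)
    then have "(X * Y) ^ n * g = (X * Y) ^ n * (lconst (coeff (coeff G (Suc n)) n) * X
        + lconst (coeff (coeff G n) (Suc n)) * Y + lconst (coeff (coeff G n) n))"
      using rep by (simp add: laurent_rep_def power_mult_distrib algebra_simps)
    then show ?thesis using XY by auto
  qed
  show ?thesis
  proof (cases "f = 0")
    case True
    then show ?thesis by (intro exI[of _ 0]) (simp add: lconst_simps)
  next
    case False
    obtain n G where rep: "laurent_rep c d X Y n G f" using laurent_rep_exists[OF surf f(1)] by blast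
    have "0 \<le> ldeg X" "0 \<le> ldeg Y" using pq by auto
    then obtain l m where lm: "\<forall>i j. (i, j) \<in> expts G \<longrightarrow> l \<le> i \<and> m \<le> j"
      "coeff G l \<noteq> 0" "d ^ (n - l) dvd coeff G l"
      "int l * ldeg X + (3 * int (n - l) + int m) * ldeg Y \<le> ldeg f + int n * (ldeg X + ldeg Y)"
      "(3 * int (n - m) + int l) * ldeg X + int m * ldeg Y \<le> ldeg f + int n * (ldeg X + ldeg Y)"
      using laurent_rep_corner[OF cd ind False rep] by blast
    note lm = lm[unfolded pq]
    have below: "coeff G i = 0" if "i < l" for i
      using lm(1) that by (force simp: expts_def poly_eq_iff)
    show ?thesis
    proof (cases "l < n")
      case False
      from polynomial_case[OF rep f(2)] below False
      obtain \<alpha> \<beta> \<delta> where "f = lconst \<alpha> * X + lconst \<beta> * Y + lconst \<delta>" by force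
      then show ?thesis by (intro exI[of _ \<alpha>] exI[of _ \<beta>] exI[of _ 0] exI[of _ \<delta>]) (simp add: lconst_simps)
    next
      case True
      then have "int (n - l) = int n - int l" by auto
      then have 1: "int n + int m \<le> 1 + 2 * int l" using lm(4) f(2) by simp
      then have "m < n" using True by linarith
      then have "int (n - m) = int n - int m" by auto
      then have "int n + int l \<le> 1 + 2 * int m" using lm(5) f(2) by simp
      \<comment> \<open>Adding the two corner inequalities gives 2n <= l + m + 2, while l and m are
        at most n - 1.\<close>
      then have nlm: "n = Suc l" "m = l" using 1 True by linarith+
      from lm(3) obtain h where h: "coeff G l = d * h" by (auto simp: nlm)
      have h0: "h \<noteq> 0" using h lm(2) by auto
      have d: "degree d = 3" "d \<noteq> 0" using P3xD[OF cd(2)] by auto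
      have "(l, degree (coeff G l)) \<in> expts G" using lm(2) by (simp add: expts_def)
      from ldeg_eval2[OF ind this] have "int l + int (degree (coeff G l)) \<le> ldeg ((X * Y) ^ n * f)"
        using rep pq by (simp add: laurent_rep_def)
      also have "\<dots> \<le> 2 * int n + 1" using XY False f(2) pq by (simp add: ldeg_mult ldeg_power)
      finally have dh: "degree h \<le> l" using h d h0 by (simp add: degree_mult_eq nlm)
      have "l \<le> order 0 h"
      proof -
        have "coeff (coeff G l) j = 0" if "j < l" for j
          using lm(1)[rule_format, of l j] that nlm(2) by (auto simp: expts_def)
        then have "[:- 0, 1:] ^ l dvd d * h"
          using monom_1_dvd_iff'[of l "d * h"] h by (simp add: monom_altdef)
        then have "l \<le> order 0 (d * h)" using order_divides[of 0 l "d * h"] h0 d by auto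
        moreover have "order 0 d = 0"
          using P3xD(4)[OF cd(2)] by (intro order_0I) (simp add: poly_0_coeff_0)
        ultimately show ?thesis using h0 d by (simp add: order_mult)
      qed
      then have "[:- 0, 1:] ^ l dvd h" using order_divides[of 0 l h] by blast
      then have "\<forall>j<l. coeff h j = 0" using monom_1_dvd_iff'[of l h] by (simp add: monom_altdef)
      then have hl: "coeff h j = 0" if "j \<noteq> l" for j
        using that dh by (cases "j < l") (auto intro: coeff_eq_0)
      define e where "e = coeff h l"
      have hm: "h = monom e l" by (rule poly_eqI) (auto simp: e_def hl)
      \<comment> \<open>Row 0 of the numerator of \<open>Z\<close> is \<open>coeff c 0\<close> times
        \<open>d\<close>; this multiple of \<open>Z\<close> therefore cancels the lowest row of
        \<open>f\<close>.\<close>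
      define e' where "e' = e * unit_inv (coeff c 0)"
      have e': "e' * coeff c 0 = e" using P3xD(2)[OF cd(1)] by (simp add: e'_def mult.commute mult.left_commute)
      define g where "g = f + lconst (- e') * Z"
      define K where "K = [:[:- e':]:] * (mono_xy ^ l * surf_num c d)"
      have "laurent_rep c d X Y n K (lconst (- e') * (1 * Z))"
        using laurent_rep_mult[OF laurent_rep_0[of c d X Y "[:[:- e':]:]"]
          laurent_rep_mult[OF laurent_rep_1[of c d X Y l] laurent_rep_z[OF surf]]]
        unfolding K_def eval2_const_const nlm by simp
      from laurent_rep_add[OF rep this] have "laurent_rep c d X Y n (G + K) g"
        by (simp add: g_def)
      moreover have "ldeg (lconst (- e') * Z) \<le> 1"
        using ldeg_on_surf_z[OF cd surf pq]
        by (cases "e' = 0 \<or> Z = 0") (auto simp: ldeg_mult ldeg_uminus lconst_simps ldeg_def[of 0])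
      then have "ldeg g \<le> 1" unfolding g_def using f(2) by (intro ldeg_add_le) auto
      moreover have "coeff (G + K) i = 0" if "i < n" for i
      proof -
        have K: "coeff K i = (if i = l then smult (- e') (monom 1 l * smult (coeff c 0) d) else 0)"
          using that nlm by (auto simp: K_def mono_xy_power coeff_monom_mult surf_num_coeff_0)
        show ?thesis
        proof (cases "i = l")
          case True
          have "coeff (G + K) l = d * monom e l - smult (e' * coeff c 0) (monom 1 l * d)"
            using True K by (simp add: h hm)
          also have "\<dots> = d * (monom e l - smult e (monom 1 l))"
            by (simp add: e' algebra_simps)
          finally show ?thesis by (simp add: True smult_monom)
        qed (use that nlm below K in auto)
      qed
      ultimately obtain \<alpha> \<beta> \<delta> where "g = lconst \<alpha> * X + lconst \<beta> * Y + lconst \<delta>"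
        using polynomial_case by metis
      then have "f = lconst \<alpha> * X + lconst \<beta> * Y + lconst e' * Z + lconst \<delta>"
        by (simp add: g_def lconst_simps algebra_simps)
      then show ?thesis by blast
    qed
  qed
qed

section \<open>The coordinate ring\<close>

text \<open>The quotient of \<open>surf_num\<close> by xy: the last two factors are the inverses of
  \<open>lx\<close> and \<open>ly\<close>.\<close>

definition lz :: "'a::idom poly \<Rightarrow> 'a poly \<Rightarrow> 'a fls fls" where
  "lz a b = eval2 lx ly (surf_num a b) * (fls_const fls_X_inv * fls_X) * fls_X"

lemma on_surf_lz: "on_surf a b lx ly (lz a b)"
proof -
  have "lx * ly * lz a b =
      eval2 lx ly (surf_num a b) * (lx * (fls_const fls_X_inv * fls_X)) * (ly * fls_X)"
    by (simp only: lz_def mult_ac)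
  then show ?thesis by (simp add: lx_inverse ly_inverse on_surf_def eval2_surf_num)
qed

lemma independent_lx_ly: "independent lx (ly :: 'a::idom fls fls)"
  by (simp add: independent_def val_lx val_ly)

definition regular_map :: "'a::idom poly \<Rightarrow> 'a poly \<Rightarrow> 'a poly3 \<Rightarrow> 'a fls fls" where
  "regular_map a b = eval3 lconst lx ly (lz a b)"

abbreviation regular :: "'a::idom poly \<Rightarrow> 'a poly \<Rightarrow> 'a fls fls set" where
  "regular a b \<equiv> range (regular_map a b)"

lemma is_hom_regular_map: "is_hom (regular_map a b)"
  by (simp add: regular_map_def is_hom_eval3 is_hom_lconst)

lemmas regular_map_hom = is_homD[OF is_hom_regular_map]

lemma regular_map_simps:
  "regular_map a b (cst c) = lconst c" "regular_map a b vx = lx" "regular_map a b vy = ly"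
  "regular_map a b vz = lz a b"
  by (simp_all add: regular_map_def eval3_simps is_hom_lconst)

lemma regular_map_ev1: "regular_map a b (ev1 p t) = eval_along lconst (regular_map a b t) p"
  by (simp add: regular_map_def eval3_ev1 is_hom_lconst)

lemma eval3_surf_on_surf: "eval3 lconst X Y Z (surf c d) = 0 \<longleftrightarrow> on_surf c d X Y Z"
  by (simp add: eval3_surf is_hom_lconst on_surf_def)

text \<open>A linear isomorphism onto the surface with \<open>a\<close> and \<open>b\<close>
  exchanged; it transfers every result about y and \<open>sigma_y\<close> to x and
  \<open>sigma_x\<close>.\<close>

definition swap :: "'a::idom pmap" where
  "swap = (vy, vx, vz)"

lemma subst3_swap_surf: "subst3 swap (surf a b) = surf b a"
  by (simp add: swap_def subst3_eval3 eval3_surf is_hom_cst) (simp add: surf_def ev1_eval_along mult_ac)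

lemma subst3_swap_vars: "subst3 swap vx = vy" "subst3 swap vy = vx" "subst3 swap vz = vz"
  "subst3 swap (cst c) = cst c"
  by (simp_all add: swap_def)

lemma comp_swap_swap: "comp_pmap swap swap = id_pmap"
  using subst3_swap_vars by (simp add: swap_def id_pmap_def)

lemma eq_on_swap: "eq_on a b f g \<Longrightarrow> eq_on b a (subst3 swap f) (subst3 swap g)"
  unfolding eq_on_def
  using is_hom_dvd[OF is_hom_subst3, of "surf a b" "f - g" swap]
  by (simp add: subst3_swap_surf is_homD[OF is_hom_subst3])

lemma eq_on_cancel_vy:
  assumes "a \<in> P3x" "b \<in> P3x" "eq_on a b (vy * f) (vy * g)" shows "eq_on a b f g"
  using sigma_y_quotient_unique[OF assms eq_on_refl] .

lemma eq_on_cancel_vx: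
  assumes "a \<in> P3x" "b \<in> P3x" "eq_on a b (vx * f) (vx * g)" shows "eq_on a b f g"
proof -
  have "eq_on b a (vy * subst3 swap f) (vy * subst3 swap g)"
    using eq_on_swap[OF assms(3)] by (simp add: is_homD[OF is_hom_subst3] subst3_swap_vars)
  from eq_on_swap[OF eq_on_cancel_vy[OF assms(2,1) this]] show ?thesis
    by (simp add: subst3_comp comp_swap_swap)
qed

text \<open>On the surface xyz is a polynomial in x and y, so each factor z is absorbed by one
  factor xy.\<close>

lemma clear_denominators:
  "\<exists>n G. eq_on a b ((vx * vy) ^ n * f) (eval_along (eval_along cst vy) vx G)"
proof -
  define S where "S = eval_along (eval_along cst vy) (vx :: 'a poly3)"
  have hom: "is_hom S" by (simp add: S_def is_hom_eval_along is_hom_cst)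
  note S = is_homD[OF hom]
  have Sc: "S [:[:c:]:] = cst c" for c
    by (simp add: S_def eval_along_const is_hom_eval_along is_hom_cst)
  have Sy: "S [:[:0, 1:]:] = vy"
    by (simp add: S_def eval_along_const eval_along_var is_hom_eval_along is_hom_cst)
  have Sx: "S [:0, 1:] = vx"
    unfolding S_def by (rule eval_along_var) (simp add: is_hom_eval_along is_hom_cst)
  have Sev: "S (eval_along (\<lambda>c. [:[:c:]:]) t p) = ev1 p (S t)" for t p
    unfolding hom_eval_along[OF hom is_hom_comp[OF is_hom_const_poly is_hom_const_poly]] Sc
      ev1_eval_along ..
  have 0: "\<exists>n G. eq_on a b ((vx * vy) ^ n * S t) (S G)" for t
    by (intro exI[of _ 0] exI[of _ t]) simp
  have "\<exists>n G. eq_on a b ((vx * vy) ^ n * f) (S G)"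
  proof (induction f rule: poly3_induct)
    case (const c) show ?case using 0[of "[:[:c:]:]"] by (simp only: Sc)
  next
    case x show ?case using 0[of "[:0, 1:]"] by (simp only: Sx)
  next
    case y show ?case using 0[of "[:[:0, 1:]:]"] by (simp only: Sy)
  next
    case z
    define G where "G = [:[:coeff b 0:]:] * eval_along (\<lambda>c. [:[:c:]:]) [:0, 1:] a
      + [:[:coeff a 0:]:] * eval_along (\<lambda>c. [:[:c:]:]) [:[:0, 1:]:] b - [:[:coeff a 0:]:] * [:[:coeff b 0:]:]"
    have "(vx * vy) ^ 1 * vz - S G = surf a b"
      unfolding G_def surf_def S(2,3,6) Sev Sc Sx Sy by simp
    then show ?case unfolding eq_on_def by (metis dvd_refl)
  next
    case (add f g)
    then obtain n G k H where *: "eq_on a b ((vx * vy) ^ n * f) (S G)"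
      "eq_on a b ((vx * vy) ^ k * g) (S H)" by blast
    have "(vx * vy) ^ (n + k) * (f + g) =
        (vx * vy) ^ k * ((vx * vy) ^ n * f) + (vx * vy) ^ n * ((vx * vy) ^ k * g)"
      by (simp add: algebra_simps power_add)
    moreover have "(vx * vy) ^ i = S (([:0, 1:] * [:[:0, 1:]:]) ^ i)" for i
      by (simp only: S Sx Sy)
    ultimately have "eq_on a b ((vx * vy) ^ (n + k) * (f + g))
        (S (([:0, 1:] * [:[:0, 1:]:]) ^ k * G + ([:0, 1:] * [:[:0, 1:]:]) ^ n * H))"
      unfolding S(2,3) using * by (simp only: eq_on_add eq_on_mult eq_on_refl)
    then show ?case by blast
  next
    case (mult f g)
    then obtain n G k H where *: "eq_on a b ((vx * vy) ^ n * f) (S G)"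
      "eq_on a b ((vx * vy) ^ k * g) (S H)" by blast
    have "(vx * vy) ^ (n + k) * (f * g) = ((vx * vy) ^ n * f) * ((vx * vy) ^ k * g)"
      by (simp add: power_add mult_ac)
    then have "eq_on a b ((vx * vy) ^ (n + k) * (f * g)) (S (G * H))"
      unfolding S(3) using eq_on_mult[OF *] by (simp only:)
    then show ?case by blast
  qed
  then show ?thesis by (simp add: S_def)
qed

text \<open>Injectivity on the coordinate ring: the numerator of an element of the kernel vanishes
  by independence of \<open>lx\<close> and \<open>ly\<close>, and x and y are then cancelled as
  nonzerodivisors.\<close>

lemma regular_map_eq_0_iff:
  assumes "a \<in> P3x" "b \<in> P3x"
  shows "regular_map a b f = 0 \<longleftrightarrow> surf a b dvd f"
proof
  have s: "regular_map a b (surf a b) = 0"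
    unfolding regular_map_def eval3_surf_on_surf by (rule on_surf_lz)
  show "surf a b dvd f \<Longrightarrow> regular_map a b f = 0"
    using is_hom_dvd[OF is_hom_regular_map, of "surf a b" f a b] s by simp
  assume f: "regular_map a b f = 0"
  obtain n G where G: "eq_on a b ((vx * vy) ^ n * f) (eval_along (eval_along cst vy) vx G)"
    using clear_denominators by blast
  then have "regular_map a b (eval_along (eval_along cst vy) vx G) = 0"
    using is_hom_dvd[OF is_hom_regular_map, of "surf a b" _ a b] s f
    by (fastforce simp: eq_on_def regular_map_hom)
  moreover have "regular_map a b (eval_along (eval_along cst vy) vx G) = eval2 lx ly G"
    by (simp add: eval2_def hom_eval_along is_hom_regular_map is_hom_eval_along is_hom_cst
        regular_map_simps)
  ultimately have "G = 0" using val_eval2(1)[OF independent_lx_ly] by metis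
  then have "eq_on a b ((vx * vy) ^ n * f) 0" using G by simp
  then have "eq_on a b f 0"
  proof (induction n)
    case (Suc n)
    then have "eq_on a b (vx * (vy * ((vx * vy) ^ n * f))) (vx * (vy * 0))" by (simp add: mult_ac)
    then show ?case using Suc.IH eq_on_cancel_vx[OF assms] eq_on_cancel_vy[OF assms] by blast
  qed simp
  then show "surf a b dvd f" by (simp add: eq_on_def)
qed

lemma eq_on_iff_regular_map:
  assumes "a \<in> P3x" "b \<in> P3x"
  shows "eq_on a b f g \<longleftrightarrow> regular_map a b f = regular_map a b g"
  using regular_map_eq_0_iff[OF assms, of "f - g"] by (simp add: eq_on_def regular_map_hom)

lemma regular_map_subst3:
  "regular_map a b (subst3 (U, V, W) f) =
    eval3 lconst (regular_map a b U) (regular_map a b V) (regular_map a b W) f"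
  by (simp add: regular_map_def eval3_subst3 is_hom_lconst)

section \<open>Charts\<close>

text \<open>Isomorphisms \<open>S\<^sub>a\<^sub>,\<^sub>b \<rightarrow> S\<^sub>c\<^sub>,\<^sub>d\<close> in terms of the pullbacks of the coordinates.\<close>

definition chart :: "'a::idom poly \<Rightarrow> 'a poly \<Rightarrow> 'a poly \<Rightarrow> 'a poly \<Rightarrow>
    'a fls fls \<Rightarrow> 'a fls fls \<Rightarrow> 'a fls fls \<Rightarrow> bool" where
  "chart a b c d X Y Z \<longleftrightarrow> range (eval3 lconst X Y Z) = regular a b \<and>
     (\<forall>f. eval3 lconst X Y Z f = 0 \<longleftrightarrow> surf c d dvd f)"

lemma range_eval3_closed:
  fixes X Y Z :: "'a::idom fls fls"
  defines "P \<equiv> range (eval3 lconst X Y Z)"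
  shows "f \<in> P \<Longrightarrow> g \<in> P \<Longrightarrow> f + g \<in> P" "f \<in> P \<Longrightarrow> g \<in> P \<Longrightarrow> f - g \<in> P"
    "f \<in> P \<Longrightarrow> g \<in> P \<Longrightarrow> f * g \<in> P" "f \<in> P \<Longrightarrow> - f \<in> P"
    "lconst c \<in> P" "X \<in> P" "Y \<in> P" "Z \<in> P" "f \<in> P \<Longrightarrow> eval_along lconst f p \<in> P"
proof -
  note hom = is_homD[OF is_hom_eval3[OF is_hom_lconst, of X Y Z], symmetric]
  show "f \<in> P \<Longrightarrow> g \<in> P \<Longrightarrow> f + g \<in> P" "f \<in> P \<Longrightarrow> g \<in> P \<Longrightarrow> f - g \<in> P"
    "f \<in> P \<Longrightarrow> g \<in> P \<Longrightarrow> f * g \<in> P" "f \<in> P \<Longrightarrow> - f \<in> P"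
    unfolding P_def by (elim rangeE, simp only: hom rangeI)+
  show "lconst c \<in> P" "X \<in> P" "Y \<in> P" "Z \<in> P"
    unfolding P_def using eval3_simps[OF is_hom_lconst] by (metis rangeI)+
  show "f \<in> P \<Longrightarrow> eval_along lconst f p \<in> P"
    unfolding P_def by (elim rangeE, simp only: eval3_ev1[OF is_hom_lconst, symmetric] rangeI)
qed

lemmas regular_closed = range_eval3_closed[where X = lx and Y = ly and Z = "lz a b" for a b,
    folded regular_map_def]

text \<open>One composite being the identity gives the range; the other gives the kernel.\<close>

lemma surf_iso_chart:
  assumes ab: "a \<in> P3x" "b \<in> P3x" and iso: "surf_iso a b c d (P, Q, W)"
  shows "chart a b c d (regular_map a b P) (regular_map a b Q) (regular_map a b W)"
proof -
  define \<phi> where "\<phi> = (P, Q, W)"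
  obtain \<psi> where \<psi>: "surf_morphism a b c d \<phi>" "surf_morphism c d a b \<psi>"
    "pmap_eq_on a b (comp_pmap \<psi> \<phi>) id_pmap" "pmap_eq_on c d (comp_pmap \<phi> \<psi>) id_pmap"
    using iso unfolding surf_iso_def \<phi>_def by blast
  define E where "E = eval3 lconst (regular_map a b P) (regular_map a b Q) (regular_map a b W)"
  have E: "E f = regular_map a b (subst3 \<phi> f)" for f
    by (simp add: E_def \<phi>_def regular_map_subst3)
  obtain P' Q' W' where \<psi>': "\<psi> = (P', Q', W')" by (cases \<psi>)
  have inv: "E P' = lx" "E Q' = ly" "E W' = lz a b"
    using \<psi>(3) by (simp_all add: E \<psi>' id_pmap_def eq_on_iff_regular_map[OF ab] regular_map_simps)
  have closed: "lx \<in> range E" "ly \<in> range E" "lz a b \<in> range E"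
    using inv by (metis rangeI)+
  have "range E = regular a b"
  proof
    show "range E \<subseteq> regular a b" by (auto simp: E)
    note cl = range_eval3_closed[where X = "regular_map a b P" and Y = "regular_map a b Q"
        and Z = "regular_map a b W", folded E_def]
    have "regular_map a b f \<in> range E" for f
      by (induction f rule: poly3_induct)
        (simp_all only: regular_map_simps regular_map_hom closed cl)
    then show "regular a b \<subseteq> range E" by auto
  qed
  moreover have "E f = 0 \<longleftrightarrow> surf c d dvd f" for f
  proof
    assume "E f = 0"
    then have "eq_on a b (subst3 \<phi> f) 0"
      by (simp add: E eq_on_iff_regular_map[OF ab] regular_map_hom)
    from morphism_subst3_eq_on[OF \<psi>(2) this]
    have "eq_on c d (subst3 (comp_pmap \<phi> \<psi>) f) 0"
      by (simp add: subst3_comp is_homD[OF is_hom_subst3])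
    from eq_on_trans[OF eq_on_sym[OF subst3_cong[OF \<psi>(4), of f]] this]
    show "surf c d dvd f" by (simp add: eq_on_def)
  next
    assume "surf c d dvd f"
    then have "eq_on c d f 0" by (simp add: eq_on_def)
    from morphism_subst3_eq_on[OF \<psi>(1) this] show "E f = 0"
      by (simp add: E eq_on_iff_regular_map[OF ab] regular_map_hom is_homD[OF is_hom_subst3])
  qed
  ultimately show ?thesis by (simp add: chart_def E_def)
qed

lemma chart_on_surf: "chart a b c d X Y Z \<Longrightarrow> on_surf c d X Y Z"
  unfolding chart_def by (metis eval3_surf_on_surf dvd_refl)

lemma eval3_swap: "eval3 lconst X Y Z (subst3 swap f) = eval3 lconst Y X Z f"
  by (simp add: swap_def eval3_subst3 eval3_simps is_hom_lconst)

lemma chart_swap: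
  assumes "chart a b c d X Y Z" shows "chart a b d c Y X Z"
proof -
  have "range (eval3 lconst Y X Z) = range (eval3 lconst X Y Z)"
    using eval3_swap[of X Y Z] eval3_swap[of Y X Z] by (metis (no_types) image_subset_iff rangeI subset_antisym)
  moreover have "surf c d dvd subst3 swap f \<longleftrightarrow> surf d c dvd f" for f
    using is_hom_dvd[OF is_hom_subst3, of "surf c d" "subst3 swap f" swap]
      is_hom_dvd[OF is_hom_subst3, of "surf d c" f swap]
    by (auto simp: subst3_swap_surf subst3_comp comp_swap_swap)
  ultimately show ?thesis
    using assms unfolding chart_def by (metis eval3_swap)
qed

text \<open>The degree bound for the identity chart, where both weights are 1. It serves as: regular
  functions of degree at most 0 are constant.\<close>

lemma regular_ldeg_ge_1:
  assumes "a \<in> P3x" "b \<in> P3x" "f \<in> regular a b" "f \<notin> range lconst"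
  shows "1 \<le> ldeg f"
proof -
  obtain n G where "laurent_rep a b lx ly n G f"
    using laurent_rep_exists[OF on_surf_lz] assms(3) unfolding regular_map_def by blast
  from laurent_rep_ldeg_bound[OF assms(1,2) independent_lx_ly this _ _ _ _ assms(4)]
  show ?thesis by (simp add: ldeg_lx ldeg_ly)
qed

section \<open>Closure of the regular functions under the bracket\<close>

lemma regular_derivation:
  assumes "is_derivation D" "D lx \<in> regular a b" "D ly \<in> regular a b" "D (lz a b) \<in> regular a b"
    "f \<in> regular a b"
  shows "D f \<in> regular a b"
proof -
  have "D (regular_map a b g) \<in> regular a b" for g
  proof (induction g rule: poly3_induct)
    case (const c)
    show ?case using regular_closed(5)[where c = 0] assms(1)
      by (simp add: regular_map_simps is_derivationD lconst_simps)
  next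
    case (mult f g)
    then show ?case by (simp add: regular_map_hom is_derivationD[OF assms(1)] regular_closed)
  qed (simp_all only: regular_map_simps regular_map_hom is_derivationD[OF assms(1)] assms regular_closed)
  then show ?thesis using assms(5) by auto
qed

text \<open>Bracketing the surface equation with x kills its terms in x alone. All that remains has
  the factor xy, which cancels and leaves a polynomial in x, y, z.\<close>

lemma bracket_lz_lx: "bracket (lz a b) lx \<in> regular a b"
proof -
  define A B b' where "A = eval_along lconst lx a" and "B = eval_along lconst ly b"
    and "b' = eval_along lconst ly (pderiv b)"
  note D = is_derivationD[OF is_derivation_bracket(2)[where g = lx]]
  have yx: "bracket ly lx = - (lx * ly)"
    by (rule trans[OF bracket_swap]) (simp only: bracket_lx_ly)
  have "bracket (lx * ly * lz a b) lx = lconst (coeff a 0) * (b' * bracket ly lx)"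
    using on_surf_lz[of a b]
    by (simp add: on_surf_def D derivation_eval_along[OF is_derivation_bracket(2)] b'_def)
  then have "lx * ly * bracket (lz a b) lx = lx * ly * (lx * lz a b - lconst (coeff a 0) * b')"
    by (simp add: D yx algebra_simps)
  then have "bracket (lz a b) lx = lx * lz a b - lconst (coeff a 0) * b'" by simp
  then show ?thesis unfolding b'_def by (simp only: regular_closed)
qed

lemma bracket_lz_ly: "bracket (lz a b) ly \<in> regular a b"
proof -
  define a' where "a' = eval_along lconst lx (pderiv a)"
  note D = is_derivationD[OF is_derivation_bracket(2)[where g = ly]]
  have "bracket (lx * ly * lz a b) ly = lconst (coeff b 0) * (a' * bracket lx ly)"
    using on_surf_lz[of a b]
    by (simp add: on_surf_def D derivation_eval_along[OF is_derivation_bracket(2)] a'_def)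
  then have "lx * ly * bracket (lz a b) ly = lx * ly * (lconst (coeff b 0) * a' - ly * lz a b)"
    by (simp add: D bracket_lx_ly algebra_simps)
  then have "bracket (lz a b) ly = lconst (coeff b 0) * a' - ly * lz a b" by simp
  then show ?thesis unfolding a'_def by (simp only: regular_closed)
qed

lemma regular_bracket:
  assumes "f \<in> regular a b" "g \<in> regular a b"
  shows "bracket f g \<in> regular a b"
proof -
  have zero: "0 \<in> regular a b" using regular_closed(5)[where c = 0] by (simp add: lconst_simps)
  have xy: "bracket lx ly \<in> regular a b" unfolding bracket_lx_ly by (simp only: regular_closed)
  have neg: "bracket k h \<in> regular a b" if "bracket h k \<in> regular a b" for h k
    unfolding bracket_swap[of k h] using that by (simp only: regular_closed)
  note D = regular_derivation[OF is_derivation_bracket(2) _ _ _ assms(1)]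
  have "bracket f lx \<in> regular a b"
    by (rule D) (simp_all only: zero bracket_self bracket_lz_lx neg[OF xy])
  moreover have "bracket f ly \<in> regular a b"
    by (rule D) (simp_all only: zero bracket_self bracket_lz_ly xy)
  moreover have "bracket f (lz a b) \<in> regular a b"
    by (rule D) (simp_all only: zero bracket_self neg[OF bracket_lz_ly] neg[OF bracket_lz_lx])
  ultimately show ?thesis
    using assms(2) by (rule regular_derivation[OF is_derivation_bracket(1)])
qed

text \<open>Descending induction on the index: once \<open>D\<close> divides the next higher
  coefficient of \<open>G\<close>, it divides \<open>B\<close> times the present one, and
  \<open>B\<close> cancels.\<close>

lemma const_dvd_linear_mult:
  fixes A B D :: "'a::idom"
  assumes "[:D:] dvd [:A, B:] * G" "\<And>p. D dvd B * p \<Longrightarrow> D dvd p"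
  shows "[:D:] dvd G"
proof -
  have d: "D dvd A * coeff G (Suc n) + B * coeff G n" for n
  proof -
    have "D dvd coeff ([:A, B:] * G) (Suc n)"
      using assms(1) unfolding const_poly_dvd_iff by blast
    then show ?thesis by simp
  qed
  have "D dvd coeff G n" if "degree G < n + k" for n k
    using that
  proof (induction k arbitrary: n)
    case (Suc k)
    then have "D dvd coeff G (Suc n)" by simp
    with d[of n] have "D dvd B * coeff G n" by (metis dvd_add_right_iff dvd_mult)
    then show ?case by (rule assms(2))
  qed (simp add: coeff_eq_0)
  from this[of _ "Suc (degree G)"] show ?thesis by (simp add: const_poly_dvd_iff)
qed

text \<open>The unit constant term of \<open>d\<close> makes the variable invertible modulo
  \<open>d\<close>.\<close>

lemma P3x_dvd_var_mult:
  assumes "d \<in> P3x" "t dvd 1" "d dvd [:0, t:] * p"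
  shows "d dvd p"
proof -
  define s where "s = unit_inv (coeff d 0)"
  define r where "r = unit_inv t"
  have "coeff d 0 * s = 1" "t * r = 1"
    using P3xD(2)[OF assms(1)] unit_inv_mult[OF assms(2)] by (auto simp: s_def r_def)
  then have 1: "[:coeff d 0:] * [:s:] = 1" "[:t:] * [:r:] = 1"
    by (simp_all add: one_pCons mult.commute)
  obtain q where "[:0, t:] * p = d * q" using assms(3) by (elim dvdE)
  then have "[:0, 1:] * [:t:] * p = d * q" by simp
  moreover have "d = [:0, 1:] * star_poly d + [:coeff d 0:]" by (rule star_poly_decomp)
  ultimately have "p = d * ([:s:] * (p - star_poly d * [:r:] * q))"
    using 1 by algebra
  then show ?thesis by (rule dvdI)
qed

text \<open>Modulo \<open>x\<close>, the coordinate ring becomes \<open>R[y,z]/(d(y))\<close>, where \<open>y\<close> is invertible; so the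
  polynomial multiplied with \<open>g\<close>, being linear in \<open>z\<close> with leading coefficient a unit times \<open>y\<close>,
  is not a zero divisor there.\<close>

lemma sigma_y_x_nonzerodivisor:
  assumes cd: "c \<in> P3x" "d \<in> P3x" and eq: "eq_on c d (sigma_y_x c d * g) (vx * h)"
  shows "\<exists>k. eq_on c d g (vx * k)"
proof -
  define t where "t = unit_inv (coeff d 0)"
  have t: "t * coeff d 0 = 1" using P3xD(2)[OF cd(2)] by (simp add: t_def mult.commute)
  then have t1: "t dvd 1" by (metis dvdI)
  define K where "K = (\<lambda>c::'a. [:[:c:]:])"
  have K: "is_hom K" unfolding K_def by (rule is_hom_comp[OF is_hom_const_poly is_hom_const_poly])
  \<comment> \<open>\<open>r\<close> sets x = 0 and lands in R[y][z], while \<open>l\<close> lifts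
    back; by \<open>decomp\<close> they are inverse modulo x.\<close>
  define r where "r = eval3 K 0 [:[:0, 1:]:] [:0, 1:]"
  define l where "l = eval_along (eval_along cst vy) (vz :: 'a poly3)"
  have hr: "is_hom r" by (simp add: r_def is_hom_eval3 K)
  have hl: "is_hom l" by (simp add: l_def is_hom_eval_along is_hom_cst)
  note r = is_homD[OF hr] and l = is_homD[OF hl]
  have rv: "r (cst e) = [:[:e:]:]" "r vx = 0" "r vy = [:[:0, 1:]:]" "r vz = [:0, 1:]" for e
    by (simp_all add: r_def eval3_simps K) (simp add: K_def)
  have lv: "l [:[:e:]:] = cst e" "l [:[:0, 1:]:] = vy" "l [:0, 1:] = vz" for e
  proof -
    show "l [:[:e:]:] = cst e" "l [:[:0, 1:]:] = vy"
      by (simp_all only: l_def eval_along_const eval_along_var is_hom_eval_along is_hom_cst)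
    show "l [:0, 1:] = vz"
      unfolding l_def by (rule eval_along_var) (simp add: is_hom_eval_along is_hom_cst)
  qed
  have decomp: "vx dvd f - l (r f)" for f
  proof (induction f rule: poly3_induct)
    case (add f g)
    then have "vx dvd (f - l (r f)) + (g - l (r g))" by (rule dvd_add)
    then show ?case unfolding r l by (simp add: algebra_simps)
  next
    case (mult f g)
    then have "vx dvd (f - l (r f)) * g + l (r f) * (g - l (r g))" by simp
    then show ?case unfolding r l by (simp add: algebra_simps)
  qed (simp_all only: rv lv l diff_self dvd_0_right diff_zero dvd_refl)
  have rx: "r (ev1 p vx) = [:[:coeff p 0:]:]" for p
  proof -
    have "r (ev1 p vx) = r (vx * ev1 (star_poly p) vx + cst (coeff p 0))"
      by (simp only: ev1_decomp[of p vx])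
    then show ?thesis by (simp only: r rv) simp
  qed
  have ry: "r (ev1 p vy) = [:p:]" for p
    by (induction p) (simp_all only: ev1_0 ev1_pCons r rv, simp_all)
  have rs: "r (surf c d) = [:smult (- coeff c 0) d:]"
    unfolding surf_def r rv rx ry by simp
  have "r (sigma_y_x c d) = [:[:- coeff (star_poly c) 0:], [:0, t:]:]"
    unfolding sigma_y_x_def r rv rx t_def by simp
  moreover obtain q where q: "sigma_y_x c d * g - vx * h = surf c d * q"
    using eq unfolding eq_on_def by (elim dvdE)
  then have "r (sigma_y_x c d * g - vx * h) = r (surf c d * q)" by simp
  then have "r (sigma_y_x c d) * r g = [:d:] * ([:[:- coeff c 0:]:] * r q)"
    unfolding r rv rs by (simp add: mult_ac)
  ultimately have "[:d:] dvd [:[:- coeff (star_poly c) 0:], [:0, t:]:] * r g" by (metis dvdI)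
  then have "[:d:] dvd r g"
    by (rule const_dvd_linear_mult) (rule P3x_dvd_var_mult[OF cd(2) t1])
  then obtain k where k: "r g = [:d:] * k" by (elim dvdE)
  obtain j where j: "g - l (r g) = vx * j" using decomp[of g] by (elim dvdE)
  have "l [:d:] = ev1 d vy"
    by (simp only: l_def eval_along_const is_hom_eval_along is_hom_cst ev1_eval_along)
  then have "l (r g) = ev1 d vy * l k" by (simp only: k l)
  then have g: "g = vx * j + ev1 d vy * l k" using j by (simp add: algebra_simps)
  define u where "u = cst (unit_inv (coeff c 0))"
  have u: "u * cst (coeff c 0) = 1"
    using P3xD(2)[OF cd(1)] by (simp add: u_def mult.commute flip: cst_simps)
  have s: "surf c d = vx * (vy * vz - cst (coeff d 0) * ev1 (star_poly c) vx) - cst (coeff c 0) * ev1 d vy"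
    unfolding surf_def ev1_decomp[of c vx] by (simp add: algebra_simps)
  \<comment> \<open>The surface equation rewrites \<open>d(y)\<close> as a multiple of x, since
    \<open>coeff c 0\<close> is a unit.\<close>
  have "g - vx * (j + u * (vy * vz - cst (coeff d 0) * ev1 (star_poly c) vx) * l k) =
      surf c d * (- u * l k)"
    unfolding s g using u by algebra
  then show ?thesis unfolding eq_on_def by (metis dvdI)
qed

lemma chart_eq_on:
  assumes "chart a b c d X Y Z"
  shows "eval3 lconst X Y Z f = eval3 lconst X Y Z g \<longleftrightarrow> eq_on c d f g"
  using assms is_homD(6)[OF is_hom_eval3[OF is_hom_lconst], of X Y Z f g]
  unfolding chart_def eq_on_def by (metis right_minus_eq)

lemma chart_regular:
  assumes "chart a b c d X Y Z"
  shows "X \<in> regular a b" "Y \<in> regular a b" "Z \<in> regular a b"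
  using range_eval3_closed(6,7,8)[where X = X and Y = Y and Z = Z] assms
  by (simp_all only: chart_def)

text \<open>The pullback of the new first coordinate of \<open>sigma_y\<close> along the chart, i.e.
  the partner of \<open>X\<close> in the exchange relation.\<close>

definition exchange :: "'a::idom poly \<Rightarrow> 'a poly \<Rightarrow> 'a fls fls \<Rightarrow> 'a fls fls \<Rightarrow> 'a fls fls \<Rightarrow> 'a fls fls" where
  "exchange c d X Y Z = lconst (unit_inv (coeff d 0)) * Y * Z - eval_along lconst X (star_poly c)"

lemma eval3_sigma_y_x: "eval3 lconst X Y Z (sigma_y_x c d) = exchange c d X Y Z"
  by (simp add: sigma_y_x_def exchange_def is_homD[OF is_hom_eval3[OF is_hom_lconst]]
      eval3_simps eval3_ev1 is_hom_lconst)

lemma exchange_relation: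
  assumes "on_surf c d X Y Z" "d \<in> P3x"
  shows "X * exchange c d X Y Z =
    lconst (coeff c 0 * unit_inv (coeff d 0)) * eval_along lconst Y d"
proof -
  define u where "u = lconst (unit_inv (coeff d 0))"
  have u: "lconst (coeff d 0) * u = 1"
    using P3xD(2)[OF assms(2)] by (simp add: u_def flip: lconst_simps)
  have "X * Y * Z = lconst (coeff d 0) * (lconst (coeff c 0) + X * eval_along lconst X (star_poly c))
      + lconst (coeff c 0) * eval_along lconst Y d - lconst (coeff c 0) * lconst (coeff d 0)"
    using assms(1) unfolding on_surf_def eval_along_star[OF is_hom_lconst, of X c] .
  then show ?thesis unfolding exchange_def lconst_simps u_def[symmetric] using u by algebra
qed

text \<open>The right side of the exchange relation is a polynomial in \<open>Y\<close>, hence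
  killed by the bracket with \<open>Y\<close>. This makes \<open>X'\<close> times
  \<open>bracket X Y\<close> a multiple of \<open>X\<close>, and \<open>X'\<close> cancels modulo
  \<open>X\<close>.\<close>

lemma chart_bracket_dvd:
  assumes cd: "c \<in> P3x" "d \<in> P3x" and ch: "chart a b c d X Y Z"
  shows "\<exists>w\<in>regular a b. bracket X Y = X * w"
proof -
  define E where "E = eval3 lconst X Y Z"
  define X' where "X' = exchange c d X Y Z"
  note E = is_homD[OF is_hom_eval3[OF is_hom_lconst, of X Y Z], folded E_def]
  have rng: "range E = regular a b" using ch by (simp add: chart_def E_def)
  have X': "X' \<in> regular a b" unfolding rng[symmetric] X'_def E_def eval3_sigma_y_x[symmetric] by simp
  note D = is_derivationD[OF is_derivation_bracket(2)[where g = Y]]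
  have "bracket (X * X') Y = 0"
    unfolding X'_def exchange_relation[OF chart_on_surf[OF ch] cd(2)]
    by (simp add: D derivation_eval_along[OF is_derivation_bracket(2)])
  then have *: "X' * bracket X Y = X * (- bracket X' Y)"
    unfolding D by (simp add: mult.commute add_eq_0_iff)
  have "- bracket X' Y \<in> regular a b"
    using regular_closed(4)[OF regular_bracket[OF X' chart_regular(2)[OF ch]]] .
  then obtain h where h: "- bracket X' Y = E h" unfolding rng[symmetric] by blast
  have "bracket X Y \<in> regular a b"
    using regular_bracket[OF chart_regular(1,2)[OF ch]] .
  then obtain g where g: "bracket X Y = E g" unfolding rng[symmetric] by blast
  have EX: "E vx = X" "E (sigma_y_x c d) = X'"
    by (simp_all add: E_def eval3_simps is_hom_lconst eval3_sigma_y_x X'_def)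
  have "E (sigma_y_x c d * g) = E (vx * h)"
    using * by (simp only: E EX g h)
  then have "eq_on c d (sigma_y_x c d * g) (vx * h)"
    unfolding E_def chart_eq_on[OF ch] .
  then obtain k where "eq_on c d g (vx * k)" using sigma_y_x_nonzerodivisor[OF cd] by blast
  then have "E g = X * E k"
    unfolding chart_eq_on[OF ch, symmetric] E_def[symmetric] by (simp add: E EX)
  then show ?thesis using g rng by (metis rangeI)
qed

text \<open>If \<open>X\<close> and \<open>Y\<close> had bracket 0, \<open>Z\<close> would commute
  with both, as \<open>X * Y * Z\<close> is a polynomial in them. Since \<open>X, Y, Z\<close>
  generate the regular functions, \<open>ly\<close> would commute with \<open>X\<close> and
  \<open>Y\<close>, hence with \<open>Z\<close> and with \<open>lx\<close>, contradicting
  \<open>bracket_lx_ly\<close>.\<close>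

lemma chart_bracket_nonzero:
  fixes X Y Z :: "'a::idom fls fls"
  assumes cd: "c \<in> P3x" "d \<in> P3x" and ab: "chart a b c d X Y Z"
  shows "bracket X Y \<noteq> 0"
proof
  assume 0: "bracket X Y = 0"
  have YX: "bracket Y X = 0" using bracket_swap[of Y X] 0 by simp
  have rng: "f \<in> range (eval3 lconst X Y Z)" if "f \<in> regular a b" for f
    using that ab by (simp add: chart_def)
  have zero: "bracket f g = 0"
    if g: "bracket X g = 0" "bracket Y g = 0" "bracket Z g = 0" and f: "f \<in> regular a b" for f g
    using derivation_zero_range[OF is_derivation_bracket(2) g rng[OF f]] .
  have on: "on_surf c d X Y Z" using chart_on_surf[OF ab] .
  have "X \<noteq> 0 \<and> Y \<noteq> 0"
  proof (rule ccontr)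
    assume "\<not> (X \<noteq> 0 \<and> Y \<noteq> 0)"
    then have "X * Y = 0" by auto
    then have "eval3 lconst X Y Z (vx * vy) = 0"
      by (simp add: is_homD[OF is_hom_eval3[OF is_hom_lconst]] eval3_simps is_hom_lconst)
    then have "surf c d dvd vx * vy" using ab by (simp add: chart_def)
    then have "lx * ly = (0 :: 'a fls fls)"
      by (simp only: regular_map_eq_0_iff[OF cd, symmetric] regular_map_hom regular_map_simps)
    then show False by simp
  qed
  then have Z: "bracket Z g = 0" if "bracket X g = 0" "bracket Y g = 0" for g
  proof -
    note D = is_derivationD[OF is_derivation_bracket(2)[where g = g]]
    have "bracket (X * Y * Z) g = 0"
      using on that by (simp add: on_surf_def D derivation_eval_along[OF is_derivation_bracket(2)])
    then show ?thesis using that \<open>X \<noteq> 0 \<and> Y \<noteq> 0\<close> by (simp add: D)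
  qed
  have "bracket f X = 0" "bracket f Y = 0" if "f \<in> regular a b" for f
    using zero[OF _ _ Z that] 0 YX by auto
  then have y: "bracket X ly = 0" "bracket Y ly = 0"
    by (simp_all only: bracket_swap[of X ly] bracket_swap[of Y ly] regular_closed(7) minus_zero)
  have "bracket lx ly = (0 :: 'a fls fls)"
    by (rule zero[OF y Z[OF y] regular_closed(6)])
  then show False by (simp add: bracket_lx_ly)
qed

lemma val_ge_bracket: "val_ge (bracket X Y) (val X + val Y)"
proof -
  have "val_ge (theta1 X * theta2 Y) (val X + val Y)" "val_ge (theta2 X * theta1 Y) (val X + val Y)"
    by (intro lcoeff_mult(2) val_ge_theta1 val_ge_theta2 val_ge_val)+
  then show ?thesis unfolding bracket_def val_ge_def lcoeff_diff by simp
qed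

text \<open>\<open>X\<close> and \<open>Y\<close> divide their bracket and are coprime. The quotient is regular of degree at most 0,
  thus constant.\<close>

lemma chart_log_canonical:
  fixes X Y Z :: "'a::idom fls fls"
  assumes ab: "a \<in> P3x" "b \<in> P3x" and cd: "c \<in> P3x" "d \<in> P3x" and ch: "chart a b c d X Y Z"
  shows "\<exists>u. u \<noteq> 0 \<and> bracket X Y = lconst u * (X * Y)" "independent X Y" "1 \<le> ldeg X" "1 \<le> ldeg Y"
proof -
  have nz: "bracket X Y \<noteq> 0" using chart_bracket_nonzero[OF cd ch] .
  obtain w where w: "w \<in> regular a b" "bracket X Y = X * w"
    using chart_bracket_dvd[OF cd ch] by blast
  obtain w' where w': "w' \<in> regular a b" "bracket Y X = Y * w'"
    using chart_bracket_dvd[OF cd(2,1) chart_swap[OF ch]] by blast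
  define X' where "X' = exchange c d X Y Z"
  define D where "D = eval_along lconst Y (star_poly d)"
  have reg: "X \<in> regular a b" "Y \<in> regular a b" "Z \<in> regular a b" using chart_regular[OF ch] by auto
  have X': "X' \<in> regular a b" unfolding X'_def exchange_def by (simp only: regular_closed reg)
  have Dr: "D \<in> regular a b" unfolding D_def by (simp only: regular_closed reg)
  define s t where "s = lconst (unit_inv (coeff c 0))" and "t = lconst (unit_inv (coeff d 0))"
  have st: "lconst (coeff c 0) * s = 1" "lconst (coeff d 0) * t = 1"
    using P3xD(2)[OF cd(1)] P3xD(2)[OF cd(2)] by (simp_all add: s_def t_def flip: lconst_simps)
  have "X * X' = lconst (coeff c 0) * t * (lconst (coeff d 0) + Y * D)"
    using exchange_relation[OF chart_on_surf[OF ch] cd(2)] eval_along_star[OF is_hom_lconst, of Y d]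
    by (simp add: X'_def D_def t_def lconst_simps)
  moreover have "X * w = - (Y * w')" using w(2) w'(2) bracket_swap[of X Y] by simp
  \<comment> \<open>Coprimality of \<open>X\<close> and \<open>Y\<close>: modulo \<open>Y\<close>,
    \<open>X * X'\<close> is the unit \<open>coeff c 0\<close>, so multiplying
    \<open>X * w = - (Y * w')\<close> by \<open>X'\<close> shows that \<open>Y\<close> divides
    \<open>w\<close>.\<close>
  ultimately have wY: "w = Y * (s * (- (w' * X') - lconst (coeff c 0) * t * D * w))"
    using st by algebra
  define v where "v = s * (- (w' * X') - lconst (coeff c 0) * t * D * w)"
  have vr: "v \<in> regular a b"
    unfolding v_def s_def t_def by (simp only: regular_closed X' Dr w(1) w'(1))
  have br: "bracket X Y = v * (X * Y)" using w(2) wY by (simp add: v_def mult_ac)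
  have nzs: "X \<noteq> 0" "Y \<noteq> 0" "v \<noteq> 0" using nz br by auto
  \<comment> \<open>The bracket is at least as small as the product in the valuation, so the
    quotient \<open>v\<close> has degree at most 0.\<close>
  have "val X + val Y \<le> val (bracket X Y)" using val_ge_imp_le[OF nz val_ge_bracket] .
  also have "\<dots> = val v + (val X + val Y)" using nzs by (simp add: br val_mult)
  finally have "fst (val X + val Y) \<le> fst (val v + (val X + val Y))"
    by (auto simp: less_eq_prod_def)
  then have "ldeg v \<le> 0" by (simp add: ldeg_val)
  then obtain u where u: "v = lconst u" using regular_ldeg_ge_1[OF ab vr] by force
  show "\<exists>u. u \<noteq> 0 \<and> bracket X Y = lconst u * (X * Y)" using br nzs u by auto
  show "independent X Y"
    unfolding independent_def using nzs br u bracket_log_canonical_det[of X Y u] by auto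
  have "X \<notin> range lconst" "Y \<notin> range lconst"
    using nz is_derivationD(3)[OF is_derivation_bracket(1)] is_derivationD(3)[OF is_derivation_bracket(2)]
    by fastforce+
  then show "1 \<le> ldeg X" "1 \<le> ldeg Y" using regular_ldeg_ge_1[OF ab] reg by auto
qed

section \<open>The generators are isomorphisms\<close>

lemma bar_poly_coeff_0: "a \<in> P3x \<Longrightarrow> coeff (bar_poly a) 0 = coeff a 0"
  by (simp add: bar_poly_expand)

lemma bar_poly_bar_poly:
  assumes "a \<in> P3x" shows "bar_poly (bar_poly a) = a"
proof -
  define a0 a1 a2 a3 u v where "a0 = coeff a 0" and "a1 = coeff a 1" and "a2 = coeff a 2"
    and "a3 = coeff a 3" and "u = unit_inv a0" and "v = unit_inv a3"
  note defs = this
  have uv: "a0 * u = 1" "a3 * v = 1" using P3xD[OF assms] by (auto simp: defs)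
  have inv: "unit_inv (a0 * a3) = u * v" "unit_inv (u * v) = a0 * a3" "unit_inv (a0 * (u * v)) = a3"
    by (rule unit_inv_unique, use uv in algebra)+
  have bar: "bar_poly a = [:a0, a2 * v, a1 * (u * v), u * v:]"
    using bar_poly_expand[OF assms] inv(1) by (simp add: defs)
  have "bar_poly (bar_poly a) = [:a0, a1 * (u * v) * unit_inv (u * v),
      a2 * v * unit_inv (a0 * (u * v)), unit_inv (a0 * (u * v)):]"
    using bar_poly_expand[OF bar_poly_in_P3x[OF assms]] by (simp add: bar numeral_2_eq_2 numeral_3_eq_3)
  also have "\<dots> = [:a0, a1, a2, a3:]"
  proof -
    have "a1 * (u * v) * (a0 * a3) = a1" "a2 * v * a3 = a2" using uv by algebra+
    then show ?thesis by (simp only: inv)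
  qed
  also have "\<dots> = a" using P3x_expand[OF assms] by (simp add: defs)
  finally show ?thesis .
qed

lemma sigma_y_z_spec:
  assumes "a \<in> P3x" "b \<in> P3x"
  shows "eq_on a b (vy * sigma_y_z a b)
    (cst (coeff b 0) * (ev1 (star_poly (bar_poly a)) (sigma_y_x a b) + vx))"
  unfolding sigma_y_z_def by (rule someI_ex[OF sigma_y_quotient_exists[OF assms]])

context
  fixes a b :: "'a::idom poly" and X' Z' :: "'a fls fls"
  assumes ab: "a \<in> P3x" "b \<in> P3x"
  defines "X' \<equiv> regular_map a b (sigma_y_x a b)" and "Z' \<equiv> regular_map a b (sigma_y_z a b)"
begin

lemma sigma_y_coords:
  "lconst (coeff b 0) * X' = ly * lz a b - lconst (coeff b 0) * eval_along lconst lx (star_poly a)"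
  "ly * Z' = lconst (coeff b 0) * (eval_along lconst X' (star_poly (bar_poly a)) + lx)"
proof -
  have "lconst (coeff b 0) * lconst (unit_inv (coeff b 0)) = 1"
    using P3xD(2)[OF ab(2)] by (simp flip: lconst_simps)
  moreover have "X' = exchange a b lx ly (lz a b)"
    by (simp only: X'_def regular_map_def eval3_sigma_y_x)
  ultimately show "lconst (coeff b 0) * X' =
      ly * lz a b - lconst (coeff b 0) * eval_along lconst lx (star_poly a)"
    unfolding exchange_def by algebra
  show "ly * Z' = lconst (coeff b 0) * (eval_along lconst X' (star_poly (bar_poly a)) + lx)"
    using sigma_y_z_spec[OF ab] unfolding eq_on_iff_regular_map[OF ab]
    by (simp add: regular_map_hom regular_map_simps regular_map_ev1 X'_def Z'_def)
qed

text \<open>In x'yz' = b0 x'(C + x), the first summand is b0 times the value of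
  \<open>bar_poly a\<close> at x' minus a0 b0, and b0 x x' = a0 b(y) is the exchange
  relation.\<close>

lemma sigma_y_on_surf: "on_surf (bar_poly a) b X' ly Z'"
proof -
  define A B where "A = eval_along lconst lx (star_poly a)" and "B = eval_along lconst ly b"
  define C where "C = eval_along lconst X' (star_poly (bar_poly a))"
  have "eval_along lconst X' (bar_poly a) = lconst (coeff a 0) + X' * C"
    by (subst eval_along_star) (simp_all add: is_hom_lconst C_def bar_poly_coeff_0 ab)
  moreover have "lx * ly * lz a b = lconst (coeff b 0) * (lconst (coeff a 0) + lx * A)
      + lconst (coeff a 0) * B - lconst (coeff a 0) * lconst (coeff b 0)"
    using on_surf_lz[of a b] eval_along_star[OF is_hom_lconst, of lx a]
    by (simp add: on_surf_def A_def B_def)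
  moreover have "lconst (coeff b 0) * X' = ly * lz a b - lconst (coeff b 0) * A"
    "ly * Z' = lconst (coeff b 0) * (C + lx)"
    using sigma_y_coords by (simp_all add: A_def C_def)
  ultimately show ?thesis
    unfolding on_surf_def bar_poly_coeff_0[OF ab(1)] B_def[symmetric] by algebra
qed

lemma sigma_y_morphism: "surf_morphism a b (bar_poly a) b (sigma_y a b)"
  using sigma_y_on_surf unfolding surf_morphism_def eq_on_iff_regular_map[OF ab] sigma_y_def
  by (simp add: regular_map_subst3 regular_map_simps regular_map_hom eval3_surf_on_surf
      flip: X'_def Z'_def)

text \<open>The equations in \<open>sigma_y_coords\<close> solve for x and z just as they solve for
  x' and z', with \<open>a\<close> and \<open>bar_poly a\<close> exchanged.\<close>

lemma sigma_y_involution: "pmap_eq_on a b (comp_pmap (sigma_y (bar_poly a) b) (sigma_y a b)) id_pmap"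
proof -
  define E where "E = eval3 lconst X' ly Z'"
  have E: "regular_map a b (subst3 (sigma_y a b) f) = E f" for f
    by (simp add: sigma_y_def regular_map_subst3 regular_map_simps E_def flip: X'_def Z'_def)
  note Eh = is_homD[OF is_hom_eval3[OF is_hom_lconst, of X' ly Z'], folded E_def]
  have Ev: "E vx = X'" "E vy = ly" "E (cst e) = lconst e" for e
    by (simp_all add: E_def eval3_simps is_hom_lconst)
  have "lconst (unit_inv (coeff b 0)) * lconst (coeff b 0) = 1"
    using P3xD(2)[OF ab(2)] by (simp add: mult.commute flip: lconst_simps)
  then have x: "E (sigma_y_x (bar_poly a) b) = lx"
    unfolding E_def eval3_sigma_y_x exchange_def using sigma_y_coords(2) by algebra
  have "E (vy * sigma_y_z (bar_poly a) b) = E (cst (coeff b 0) *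
      (ev1 (star_poly (bar_poly (bar_poly a))) (sigma_y_x (bar_poly a) b) + vx))"
    using morphism_subst3_eq_on[OF sigma_y_morphism sigma_y_z_spec[OF bar_poly_in_P3x[OF ab(1)] ab(2)]]
    unfolding eq_on_iff_regular_map[OF ab] E .
  moreover have "E (ev1 p t) = eval_along lconst (E t) p" for p t
    by (simp add: E_def eval3_ev1 is_hom_lconst)
  ultimately have "ly * E (sigma_y_z (bar_poly a) b) =
      lconst (coeff b 0) * (eval_along lconst lx (star_poly a) + X')"
    by (simp add: Eh Ev x bar_poly_bar_poly ab)
  also have "\<dots> = ly * lz a b" using sigma_y_coords(1) by algebra
  finally have "E (sigma_y_z (bar_poly a) b) = lz a b" by simp
  then show ?thesis
    by (simp add: sigma_y_def[of "bar_poly a"] id_pmap_def eq_on_iff_regular_map[OF ab]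
        E x Ev regular_map_simps)
qed

end

lemma sigma_y_iso:
  assumes "a \<in> P3x" "b \<in> P3x" shows "surf_iso a b (bar_poly a) b (sigma_y a b)"
  unfolding surf_iso_def
  using sigma_y_morphism[OF assms] sigma_y_involution[OF assms] bar_poly_bar_poly[OF assms(1)]
    sigma_y_morphism[OF bar_poly_in_P3x[OF assms(1)] assms(2)]
    sigma_y_involution[OF bar_poly_in_P3x[OF assms(1)] assms(2)] by metis

lemma swap_iso: "surf_iso a b b a swap"
  unfolding surf_iso_def surf_morphism_def subst3_swap_surf
  using comp_swap_swap by (metis diff_zero dvd_refl eq_on_def pmap_eq_on_refl subst3_swap_surf)

lemma swap_generator: "generator a b b a swap"
proof -
  have "swap = (cst 1 * vy, cst 1 * vx, cst 1 * vz)" by (simp add: swap_def cst_simps)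
  then have "linear_iso a b b a swap"
    unfolding linear_iso_def using swap_iso by (metis dvd_refl)
  then show ?thesis by (simp add: generator_def)
qed

lemma comp_swap: "comp_pmap swap (X, Y, Z) = (Y, X, Z)"
  by (simp add: swap_def)

text \<open>The two third components come from separate uses of \<open>SOME\<close>, so equality is
  available only on the surface.\<close>

lemma sigma_x_conv_sigma_y:
  assumes "a \<in> P3x" "b \<in> P3x"
  shows "pmap_eq_on a b (comp_pmap swap (comp_pmap (sigma_y b a) swap)) (sigma_x a b)"
proof -
  note S = is_homD[OF is_hom_subst3, of swap]
  have ev: "subst3 swap (ev1 p t) = ev1 p (subst3 swap t)" for p t
    unfolding hom_ev1[OF is_hom_subst3] subst3_swap_vars by (simp only: ev1_eval_along)
  have y: "subst3 swap (sigma_y_x b a) = sigma_x_y a b"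
    by (simp add: sigma_y_x_def sigma_x_y_def S ev subst3_swap_vars)
  have *: "eq_on a b (vx * subst3 swap (sigma_y_z b a))
      (cst (coeff a 0) * (ev1 (star_poly (bar_poly b)) (sigma_x_y a b) + vy))"
    using eq_on_swap[OF sigma_y_z_spec[OF assms(2,1)]] by (simp add: S ev subst3_swap_vars y)
  then have "eq_on a b (vx * sigma_x_z a b)
      (cst (coeff a 0) * (ev1 (star_poly (bar_poly b)) (sigma_x_y a b) + vy))"
    unfolding sigma_x_z_def by (rule someI)
  then have "eq_on a b (subst3 swap (sigma_y_z b a)) (sigma_x_z a b)"
    using eq_on_cancel_vx[OF assms] * eq_on_trans eq_on_sym by blast
  then show ?thesis
    by (simp add: sigma_y_def sigma_x_def y comp_swap subst3_swap_vars)
qed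

lemma sigma_x_iso:
  assumes "a \<in> P3x" "b \<in> P3x" shows "surf_iso a b a (bar_poly b) (sigma_x a b)"
  using surf_iso_cong[OF surf_iso_comp[OF surf_iso_comp[OF swap_iso sigma_y_iso[OF assms(2,1)]] swap_iso]
      sigma_x_conv_sigma_y[OF assms]] .

lemma generated_P3x: "generated a b c d \<phi> \<Longrightarrow> c \<in> P3x \<and> d \<in> P3x"
  by (induction rule: generated.induct) auto

lemma generated_imp_surf_iso: "generated a b c d \<phi> \<Longrightarrow> surf_iso a b c d \<phi>"
proof (induction rule: generated.induct)
  case (generated_id a b \<chi>)
  then show ?case using surf_iso_cong[OF surf_iso_id] pmap_eq_on_sym by blast
next
  case (generated_step a b c d \<phi> e f \<psi> \<chi>)
  have "surf_iso c d e f \<psi>"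
    using generated_step.hyps(4) generated_P3x[OF generated_step.hyps(1)] sigma_y_iso sigma_x_iso
    by (auto simp: generator_def linear_iso_def)
  from surf_iso_comp[OF generated_step.IH this] show ?case
    using surf_iso_cong pmap_eq_on_sym[OF generated_step.hyps(5)] by blast
qed

section \<open>Charts of degree one\<close>

lemma coeff_surf_num:
  "coeff (coeff (surf_num c d) i) j = (if j = 0 then coeff d 0 * coeff c i else 0)
    + (if i = 0 then coeff c 0 * coeff d j else 0)
    - (if i = 0 \<and> j = 0 then coeff c 0 * coeff d 0 else 0)"
  by (cases i; cases j) (simp_all add: surf_num_def coeff_map_poly coeff_pCons)

text \<open>The leading term of z is a0 b3 times y^2/x, coming from the cubic term of
  \<open>b\<close>.\<close>

lemma val_lz:
  fixes a b :: "'a::idom poly"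
  assumes ab: "a \<in> P3x" "b \<in> P3x" shows "val (lz a b) = (- 1, - 1)" "lz a b \<noteq> 0"
proof -
  have "coeff a 0 * coeff b 3 \<noteq> 0" using P3xD[OF ab(1)] P3xD[OF ab(2)] by simp
  then have e: "(0, 3) \<in> expts (surf_num a b)" by (simp add: expts_def coeff_surf_num)
  then have G: "surf_num a b \<noteq> 0" by (auto simp: expts_def)
  define v where "v = val (eval2 lx ly (surf_num a b))"
  have "v \<le> (- 3, 0)"
    using val_eval2(3)[OF independent_lx_ly G e] by (simp add: val_lx val_ly v_def)
  moreover obtain i j where ij: "(i, j) \<in> expts (surf_num a b)" "v = (- (int i + int j), int i)"
    using val_eval2(2)[OF independent_lx_ly G] by (force simp: val_lx val_ly v_def)
  have "i + j \<le> 3"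
    using ij(1) le_degree[of a i] le_degree[of b j] P3xD(1)[OF ab(1)] P3xD(1)[OF ab(2)]
    by (force simp: expts_def coeff_surf_num split: if_splits)
  ultimately have v: "v = (- 3, 0)" using ij by auto
  have l: "lx * ly * lz a b = eval2 lx ly (surf_num a b)"
    using on_surf_lz[of a b] by (simp add: on_surf_def eval2_surf_num)
  then show nz: "lz a b \<noteq> 0" using val_eval2(1)[OF independent_lx_ly G] by auto
  have "v = val (lx * ly :: 'a fls fls) + val (lz a b)" unfolding v_def l[symmetric] using nz by (simp add: val_mult)
  also have "val (lx * ly :: 'a fls fls) = (- 2, 1)" by (simp add: val_mult val_lx val_ly)
  finally show "val (lz a b) = (- 1, - 1)" using v by (simp add: prod_eq_iff)
qed

text \<open>In degree one, x and y contribute exponents 1 and 0 of the inner variable. Only z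
  reaches a negative exponent, namely -1, so its presence is visible in the valuation.\<close>

lemma snd_val_affine:
  fixes a b :: "'a::idom poly"
  assumes ab: "a \<in> P3x" "b \<in> P3x" and "ldeg f = 1" "f \<noteq> 0"
    and f: "f = lconst \<alpha> * lx + lconst \<beta> * ly + lconst \<gamma> * lz a b + lconst \<delta>"
  shows "- 1 \<le> snd (val f)" "\<gamma> \<noteq> 0 \<Longrightarrow> snd (val f) = - 1"
proof -
  note lc = val_ge_less[OF val_ge_val]
  have fst: "fst (val f) = - 1" using assms(3) by (simp add: ldeg_val)
  have low: "lcoeff f (- 1, k) = \<gamma> * lcoeff (lz a b) (- 1, k)" if "k < 0" for k
    using that lc[of "(- 1, k)" "lx :: 'a fls fls"] lc[of "(- 1, k)" "ly :: 'a fls fls"]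
      lc[of "(- 1, k)" "lconst \<delta>"]
    by (simp add: f lcoeff_add lcoeff_lconst_mult val_lx val_ly val_lconst zero_prod_def)
  show ge: "- 1 \<le> snd (val f)"
  proof (rule ccontr)
    assume "\<not> - 1 \<le> snd (val f)"
    then have "lcoeff f (- 1, snd (val f)) = 0"
      using low[of "snd (val f)"] lc[of "(- 1, snd (val f))" "lz a b"] by (simp add: val_lz[OF ab])
    then show False using lcoeff_val[OF assms(4)] by (simp flip: fst)
  qed
  show "snd (val f) = - 1" if "\<gamma> \<noteq> 0"
  proof -
    have "lcoeff f (- 1, - 1) \<noteq> 0"
      using low[of "- 1"] that lcoeff_val[OF val_lz(2)[OF ab]] by (simp add: val_lz[OF ab])
    from val_le[OF this] show ?thesis using fst ge by (cases "val f") auto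
  qed
qed

text \<open>\<open>X\<close>, \<open>Y\<close>, \<open>Z\<close> are affine in x, y, z. The
  valuation of \<open>X * Y * Z\<close> excludes z from \<open>X\<close> and \<open>Y\<close>, and
  the log-canonical bracket then leaves a single variable in each.\<close>

lemma chart_degree_one:
  fixes X Y Z :: "'a::idom fls fls"
  assumes ab: "a \<in> P3x" "b \<in> P3x" and cd: "c \<in> P3x" "d \<in> P3x" and ch: "chart a b c d X Y Z"
    and pq: "ldeg X = 1" "ldeg Y = 1"
  shows "\<exists>\<alpha> \<beta>. X = lconst \<alpha> * lx \<and> Y = lconst \<beta> * ly \<or> X = lconst \<alpha> * ly \<and> Y = lconst \<beta> * lx"
proof -
  have ind: "independent X Y" using chart_log_canonical[OF ab cd ch] by blast
  then have nz: "X \<noteq> 0" "Y \<noteq> 0" by (auto simp: independent_def)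
  have on: "on_surf c d X Y Z" using chart_on_surf[OF ch] .
  have span: "\<exists>\<alpha> \<beta> \<gamma> \<delta>. f = lconst \<alpha> * lx + lconst \<beta> * ly + lconst \<gamma> * lz a b + lconst \<delta>"
    if "f \<in> regular a b" "ldeg f \<le> 1" for f
    using ldeg_one_span[OF ab independent_lx_ly on_surf_lz ldeg_lx ldeg_ly] that
    by (simp add: regular_map_def)
  obtain \<alpha> \<beta> \<gamma> \<delta> where X: "X = lconst \<alpha> * lx + lconst \<beta> * ly + lconst \<gamma> * lz a b + lconst \<delta>"
    using span[OF chart_regular(1)[OF ch]] pq by auto
  obtain \<alpha>' \<beta>' \<gamma>' \<delta>' where Y: "Y = lconst \<alpha>' * lx + lconst \<beta>' * ly + lconst \<gamma>' * lz a b + lconst \<delta>'"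
    using span[OF chart_regular(2)[OF ch]] pq by auto
  have Zle: "ldeg Z \<le> 1" using ldeg_on_surf_z[OF cd on pq] .
  then obtain \<alpha>'' \<beta>'' \<gamma>'' \<delta>'' where
    Z: "Z = lconst \<alpha>'' * lx + lconst \<beta>'' * ly + lconst \<gamma>'' * lz a b + lconst \<delta>''"
    using span[OF chart_regular(3)[OF ch]] by auto
  define m m' k where "m = snd (val X)" and "m' = snd (val Y)" and "k = snd (val Z)"
  have vX: "val X = (- 1, m)" and vY: "val Y = (- 1, m')"
    using pq by (auto simp: m_def m'_def ldeg_val prod_eq_iff)
  have mm: "m \<noteq> m'" using ind by (simp add: independent_def vX vY)
  have xyz: "X * Y * Z = eval2 X Y (surf_num c d)"
    using on by (simp add: on_surf_def eval2_surf_num)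
  have "coeff c 0 * coeff d 3 \<noteq> 0" "coeff d 0 * coeff c 3 \<noteq> 0"
    using P3xD[OF cd(1)] P3xD[OF cd(2)] by auto
  then have e: "(0, 3) \<in> expts (surf_num c d)" "(3, 0) \<in> expts (surf_num c d)"
    by (simp_all add: expts_def coeff_surf_num)
  then have G: "surf_num c d \<noteq> 0" by (auto simp: expts_def)
  have Znz: "Z \<noteq> 0" using val_eval2(1)[OF ind G] xyz by auto
  have vXYZ: "val (eval2 X Y (surf_num c d)) = (- 2 + fst (val Z), m + m' + k)"
    unfolding xyz[symmetric] using nz Znz by (simp add: val_mult vX vY k_def plus_prod_def)
  \<comment> \<open>The cubes of \<open>Y\<close> and of \<open>X\<close> both occur in the surface
    equation, so each bounds the valuation of \<open>X * Y * Z\<close>.\<close>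
  have le: "(- 2 + fst (val Z), m + m' + k) \<le> (- 3, 3 * m')"
    "(- 2 + fst (val Z), m + m' + k) \<le> (- 3, 3 * m)"
    using val_eval2(3)[OF ind G e(1)] val_eval2(3)[OF ind G e(2)] vXYZ by (simp_all add: vX vY)
  moreover have "- 1 \<le> fst (val Z)" using Zle by (simp add: ldeg_val)
  ultimately have "fst (val Z) = - 1" and mk: "m + m' + k \<le> 3 * m'" "m + m' + k \<le> 3 * m" by auto
  then have "ldeg Z = 1" by (simp add: ldeg_val)
  then have "- 1 \<le> k" using snd_val_affine(1)[OF ab _ Znz Z] by (simp add: k_def)
  moreover have "- 1 \<le> m" "- 1 \<le> m'"
    using snd_val_affine(1)[OF ab pq(1) nz(1) X] snd_val_affine(1)[OF ab pq(2) nz(2) Y]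
    by (simp_all add: m_def m'_def)
  \<comment> \<open>If one of them were -1, the bound -3 on \<open>m + m' + k\<close>, with all
    summands at least -1, would force the other to be -1 too, against \<open>mm\<close>.\<close>
  ultimately have "m \<noteq> - 1" "m' \<noteq> - 1" using mk mm by auto
  then have "\<gamma> = 0" "\<gamma>' = 0"
    using snd_val_affine(2)[OF ab pq(1) nz(1) X] snd_val_affine(2)[OF ab pq(2) nz(2) Y]
    by (auto simp: m_def m'_def)
  then have X: "X = lconst \<alpha> * lx + lconst \<beta> * ly + lconst \<delta>"
    and Y: "Y = lconst \<alpha>' * lx + lconst \<beta>' * ly + lconst \<delta>'"
    using X Y by (simp_all add: lconst_simps)
  obtain u where u: "u \<noteq> 0" "bracket X Y = lconst u * (X * Y)"
    using chart_log_canonical(1)[OF ab cd ch] by blast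
  have yx: "bracket ly lx = - (lx * ly :: 'a fls fls)"
    by (rule trans[OF bracket_swap]) (simp only: bracket_lx_ly)
  have br: "bracket X Y = lconst (\<alpha> * \<beta>' - \<alpha>' * \<beta>) * (lx * ly)"
    unfolding X Y is_derivationD(1-3)[OF is_derivation_bracket(1)]
      is_derivationD(1-3)[OF is_derivation_bracket(2)] bracket_lx_ly yx bracket_self lconst_simps
    by (simp add: algebra_simps)
  have "eval2 lx ly [:0, [:0, \<alpha> * \<beta>' - \<alpha>' * \<beta>:]:] =
      eval2 lx ly ([:[:u:]:] * ([:[:\<delta>, \<beta>:], [:\<alpha>:]:] * [:[:\<delta>', \<beta>':], [:\<alpha>':]:]))"
  proof -
    have 1: "eval2 lx ly [:0, [:0, e:]:] = lconst e * (lx * ly)" for e :: 'a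
      by (simp add: eval2_pCons eval_along_pCons is_hom_lconst lconst_simps eval2_simps mult_ac)
    have 2: "eval2 lx ly [:[:\<delta>, \<beta>:], [:\<alpha>:]:] = lconst \<alpha> * lx + lconst \<beta> * ly + lconst \<delta>" for \<alpha> \<beta> \<delta> :: 'a
      by (simp add: eval2_pCons eval_along_pCons is_hom_lconst lconst_simps eval2_simps mult_ac)
    show ?thesis using u(2) unfolding eval2_simps(3) 1 2 eval2_const_const br X[symmetric] Y[symmetric] .
  qed
  then have eq: "[:0, [:0, \<alpha> * \<beta>' - \<alpha>' * \<beta>:]:] =
      [:[:u:]:] * ([:[:\<delta>, \<beta>:], [:\<alpha>:]:] * [:[:\<delta>', \<beta>':], [:\<alpha>':]:])"
    unfolding eval2_inject[OF independent_lx_ly] .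
  \<comment> \<open>The left side of \<open>eq\<close> has only an xy term, so the coefficients of
    y, y^2, x^2 and x on the right vanish.\<close>
  have co: "\<delta> * \<beta>' + \<beta> * \<delta>' = 0" "\<beta> * \<beta>' = 0" "\<alpha> * \<alpha>' = 0" "\<delta> * \<alpha>' + \<alpha> * \<delta>' = 0"
    using u(1) arg_cong[OF eq, of "\<lambda>p. coeff (coeff p 0) 1"] arg_cong[OF eq, of "\<lambda>p. coeff (coeff p 0) 2"]
      arg_cong[OF eq, of "\<lambda>p. coeff (coeff p 2) 0"] arg_cong[OF eq, of "\<lambda>p. coeff (coeff p 1) 0"]
    by (auto simp: numeral_2_eq_2)
  have "\<alpha> \<noteq> 0 \<or> \<beta> \<noteq> 0" "\<alpha>' \<noteq> 0 \<or> \<beta>' \<noteq> 0"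
    using pq X Y by (auto simp: lconst_simps)
  then consider "\<alpha> \<noteq> 0" "\<alpha>' = 0" "\<beta> = 0" "\<beta>' \<noteq> 0" | "\<alpha> = 0" "\<beta> \<noteq> 0" "\<beta>' = 0" "\<alpha>' \<noteq> 0"
    using co by auto
  then show ?thesis
  proof cases
    case 1
    then have "\<delta> = 0" "\<delta>' = 0" using co by auto
    then show ?thesis using X Y 1 by (auto simp: lconst_simps)
  next
    case 2
    then have "\<delta> = 0" "\<delta>' = 0" using co by auto
    then show ?thesis using X Y 2 by (auto simp: lconst_simps)
  qed
qed

lemma eval_along_P3x:
  assumes "c \<in> P3x"
  shows "eval_along lconst X c = lconst (coeff c 0) + X * (lconst (coeff c 1)
    + X * (lconst (coeff c 2) + X * lconst (coeff c 3)))"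
proof -
  have "eval_along lconst X [:coeff c 0, coeff c 1, coeff c 2, coeff c 3:] =
      lconst (coeff c 0) + X * (lconst (coeff c 1) + X * (lconst (coeff c 2) + X * lconst (coeff c 3)))"
    by (simp add: eval_along_pCons is_hom_lconst)
  then show ?thesis by (simp only: P3x_expand[OF assms, symmetric])
qed

text \<open>The surface equation of \<open>c, d\<close> has no terms xy, x y^2, x^2 y, which removes
  all but z from \<open>Z\<close>. Its constant coefficient, a unit, is a multiple of all three
  scaling factors, so these are units.\<close>

lemma diagonal_chart:
  fixes X Y Z :: "'a::idom fls fls"
  assumes ab: "a \<in> P3x" "b \<in> P3x" and cd: "c \<in> P3x" "d \<in> P3x" and ch: "chart a b c d X Y Z"
    and X: "X = lconst \<alpha> * lx" and Y: "Y = lconst \<beta> * ly"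
  shows "\<exists>\<gamma>. Z = lconst \<gamma> * lz a b \<and> \<alpha> dvd 1 \<and> \<beta> dvd 1 \<and> \<gamma> dvd 1"
proof -
  have nz: "\<alpha> \<noteq> 0" "\<beta> \<noteq> 0"
    using chart_log_canonical(2)[OF ab cd ch] X Y by (auto simp: independent_def)
  then have pq: "ldeg X = 1" "ldeg Y = 1" by (simp_all add: X Y ldeg_mult ldeg_lx ldeg_ly)
  have on: "on_surf c d X Y Z" using chart_on_surf[OF ch] .
  obtain \<xi> \<eta> \<gamma> \<delta> where Z: "Z = lconst \<xi> * lx + lconst \<eta> * ly + lconst \<gamma> * lz a b + lconst \<delta>"
    using ldeg_one_span[OF ab independent_lx_ly on_surf_lz ldeg_lx ldeg_ly, of Z]
      chart_regular(3)[OF ch] ldeg_on_surf_z[OF cd on pq] by (auto simp: regular_map_def)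
  define G where "G = [:[:coeff c 0 * coeff d 0, coeff c 0 * coeff d 1 * \<beta>, coeff c 0 * coeff d 2 * \<beta> ^ 2,
    coeff c 0 * coeff d 3 * \<beta> ^ 3:], [:coeff d 0 * coeff c 1 * \<alpha>:], [:coeff d 0 * coeff c 2 * \<alpha> ^ 2:],
    [:coeff d 0 * coeff c 3 * \<alpha> ^ 3:]:]"
  define H where "H = [:[:\<alpha> * \<beta>:]:] * ([:[:\<gamma>:]:] * surf_num a b + [:0, [:0, \<delta>, \<eta>:], [:0, \<xi>:]:])"
  have "eval2 lx ly G = X * Y * Z"
    using on unfolding on_surf_def eval_along_P3x[OF cd(1)] eval_along_P3x[OF cd(2)]
    by (simp add: G_def X Y eval2_pCons eval_along_pCons is_hom_lconst eval2_simps lconst_simps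
        power2_eq_square power3_eq_cube algebra_simps)
  also have "\<dots> = eval2 lx ly H"
  proof -
    have "eval2 lx ly [:0, [:0, \<delta>, \<eta>:], [:0, \<xi>:]:] =
        lx * ly * (lconst \<delta> + ly * lconst \<eta> + lx * lconst \<xi>)"
      by (simp add: eval2_pCons eval_along_pCons is_hom_lconst eval2_simps lconst_simps algebra_simps)
    moreover have "eval2 lx ly (surf_num a b) = lx * ly * lz a b"
      using on_surf_lz[of a b] by (simp add: on_surf_def eval2_surf_num)
    ultimately show ?thesis
      unfolding H_def eval2_simps(2,3) eval2_const_const X Y Z lconst_simps(3)
      by (simp add: algebra_simps)
  qed
  finally have GH: "G = H" using eval2_inject[OF independent_lx_ly] by blast
  have "coeff (coeff G 1) 1 = coeff (coeff H 1) 1" "coeff (coeff G 1) 2 = coeff (coeff H 1) 2"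
    "coeff (coeff G 2) 1 = coeff (coeff H 2) 1" "coeff (coeff G 0) 0 = coeff (coeff H 0) 0"
    by (simp_all add: GH)
  then have co: "\<delta> = 0" "\<eta> = 0" "\<xi> = 0" "coeff c 0 * coeff d 0 = \<alpha> * \<beta> * (\<gamma> * (coeff a 0 * coeff b 0))"
    using nz by (simp_all add: G_def H_def coeff_surf_num numeral_2_eq_2 mult_ac)
  have "coeff c 0 * coeff d 0 dvd 1"
    using cd by (auto simp: P3x_def intro: mult_dvd_mono[of _ 1 _ 1, simplified])
  then have "\<alpha> dvd 1" "\<beta> dvd 1" "\<gamma> dvd 1" unfolding co(4)
    by (meson dvd_trans dvd_triv_left dvd_triv_right dvd_mult2 dvd_mult)+
  then show ?thesis using Z co by (auto simp: lconst_simps)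
qed

section \<open>Reduction of the degree\<close>

lemma generated_swap:
  assumes cd: "c \<in> P3x" "d \<in> P3x" and "generated a b d c (comp_pmap swap \<phi>)"
  shows "generated a b c d \<phi>"
proof (rule generated_step[OF assms(3) cd swap_generator])
  show "pmap_eq_on a b \<phi> (comp_pmap swap (comp_pmap swap \<phi>))"
    by (simp add: comp_pmap_assoc comp_swap_swap)
qed

text \<open>\<open>sigma_y\<close> is undone by the \<open>sigma_y\<close> of the barred surface,
  itself a generator.\<close>

lemma generated_sigma_y:
  assumes cd: "c \<in> P3x" "d \<in> P3x" and iso: "surf_iso a b c d \<phi>"
    and gen: "generated a b (bar_poly c) d (comp_pmap (sigma_y c d) \<phi>)"
  shows "generated a b c d \<phi>"
proof (rule generated_step[OF gen cd])
  show "generator (bar_poly c) d c d (sigma_y (bar_poly c) d)"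
    by (simp add: generator_def bar_poly_bar_poly cd)
  have "surf_morphism a b c d \<phi>" using iso by (simp add: surf_iso_def)
  from comp_pmap_cong_left[OF this sigma_y_involution[OF cd]]
  show "pmap_eq_on a b \<phi> (comp_pmap (sigma_y (bar_poly c) d) (comp_pmap (sigma_y c d) \<phi>))"
    by (simp add: comp_pmap_assoc pmap_eq_on_sym)
qed

lemma generated_diagonal:
  assumes ab: "a \<in> P3x" "b \<in> P3x" and cd: "c \<in> P3x" "d \<in> P3x" and iso: "surf_iso a b c d (P, Q, W)"
    and P: "regular_map a b P = lconst \<alpha> * lx" and Q: "regular_map a b Q = lconst \<beta> * ly"
  shows "generated a b c d (P, Q, W)"
proof -
  obtain \<gamma> where g: "regular_map a b W = lconst \<gamma> * lz a b" "\<alpha> dvd 1" "\<beta> dvd 1" "\<gamma> dvd 1"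
    using diagonal_chart[OF ab cd surf_iso_chart[OF ab iso] P Q] by blast
  define \<psi> where "\<psi> = (cst \<alpha> * vx, cst \<beta> * vy, cst \<gamma> * vz)"
  have eq: "pmap_eq_on a b (P, Q, W) \<psi>"
    by (simp add: \<psi>_def eq_on_iff_regular_map[OF ab] regular_map_hom regular_map_simps P Q g)
  then have "generator a b c d \<psi>"
    using surf_iso_cong[OF iso eq] g by (auto simp: generator_def linear_iso_def \<psi>_def)
  from generated_step[OF generated_id[OF ab pmap_eq_on_refl] cd this, of "(P, Q, W)"] eq
  show ?thesis by simp
qed

lemma surf_iso_imp_generated:
  fixes a b c d :: "'a::idom poly" and \<phi> :: "'a pmap"
  assumes ab: "a \<in> P3x" "b \<in> P3x"
  shows "c \<in> P3x \<Longrightarrow> d \<in> P3x \<Longrightarrow> surf_iso a b c d \<phi> \<Longrightarrow> generated a b c d \<phi>"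
proof (induction "nat (ldeg (regular_map a b (fst \<phi>)) + ldeg (regular_map a b (fst (snd \<phi>))))"
    arbitrary: c d \<phi> rule: less_induct)
  case less
  define N where "N = nat (ldeg (regular_map a b (fst \<phi>)) + ldeg (regular_map a b (fst (snd \<phi>))))"
  \<comment> \<open>Stated for arbitrary targets and maps, so that it also serves the chart with
    \<open>X\<close> and \<open>Y\<close> swapped.\<close>
  have reduce: "generated a b c d (P, Q, W)"
    if cd: "c \<in> P3x" "d \<in> P3x" and iso: "surf_iso a b c d (P, Q, W)"
      and N: "nat (ldeg (regular_map a b P) + ldeg (regular_map a b Q)) = N"
      and gt: "3 * ldeg (regular_map a b Q) < 2 * ldeg (regular_map a b P)" for c d P Q W
  proof (rule generated_sigma_y[OF cd iso])
    let ?\<phi> = "comp_pmap (sigma_y c d) (P, Q, W)"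
    define X Y Z where "X = regular_map a b P" and "Y = regular_map a b Q" and "Z = regular_map a b W"
    have ch: "chart a b c d X Y Z" unfolding X_def Y_def Z_def by (rule surf_iso_chart[OF ab iso])
    have pos: "1 \<le> ldeg X" "1 \<le> ldeg Y" using chart_log_canonical(3,4)[OF ab cd ch] by auto
    define X' where "X' = exchange c d X Y Z"
    have fst: "regular_map a b (fst ?\<phi>) = X'" "regular_map a b (fst (snd ?\<phi>)) = Y"
      by (simp_all add: sigma_y_def regular_map_subst3 eval3_sigma_y_x X'_def flip: X_def Y_def Z_def)
    have "X * X' = lconst (coeff c 0 * unit_inv (coeff d 0)) * eval_along lconst Y d"
      unfolding X'_def by (rule exchange_relation[OF chart_on_surf[OF ch] cd(2)])
    moreover have "coeff c 0 * unit_inv (coeff d 0) \<noteq> 0" "d \<noteq> 0"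
      using P3xD[OF cd(1)] P3xD[OF cd(2)] by auto
    moreover from this(2) have "ldeg (eval_along lconst Y d) = 3 * ldeg Y" "eval_along lconst Y d \<noteq> 0"
      using ldeg_eval_along[OF pos(2)] P3xD(1)[OF cd(2)] by auto
    ultimately have "X * X' \<noteq> 0" "ldeg (X * X') = 3 * ldeg Y" by (auto simp: ldeg_mult)
    then have deg: "ldeg X' = 3 * ldeg Y - ldeg X" by (simp add: ldeg_mult)
    have "nat (ldeg X' + ldeg Y) < N"
      using deg gt pos N by (simp add: X_def Y_def)
    then show "generated a b (bar_poly c) d ?\<phi>"
      using less.hyps[of ?\<phi> "bar_poly c" d] bar_poly_in_P3x[OF cd(1)] cd(2)
        surf_iso_comp[OF iso sigma_y_iso[OF cd]] unfolding fst N_def by blast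
  qed
  obtain P Q W where \<phi>: "\<phi> = (P, Q, W)" by (cases \<phi>)
  have N: "nat (ldeg (regular_map a b P) + ldeg (regular_map a b Q)) = N" by (simp add: N_def \<phi>)
  note cd = less.prems(1,2) and iso = less.prems(3)[unfolded \<phi>]
  define X Y Z where "X = regular_map a b P" and "Y = regular_map a b Q" and "Z = regular_map a b W"
  have ch: "chart a b c d X Y Z" unfolding X_def Y_def Z_def by (rule surf_iso_chart[OF ab iso])
  note lc = chart_log_canonical[OF ab cd ch]
  have iso': "surf_iso a b d c (Q, P, W)" using surf_iso_comp[OF iso swap_iso] by (simp add: comp_swap)
  have "generated a b c d (P, Q, W)"
  proof (cases "3 * ldeg Y < 2 * ldeg X")
    case True
    then show ?thesis using reduce[OF cd iso N] by (simp add: X_def Y_def)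
  next
    case XY: False
    show ?thesis
    proof (cases "3 * ldeg X < 2 * ldeg Y")
      case True
      then have "generated a b d c (Q, P, W)"
        using reduce[OF cd(2,1) iso'] N by (simp add: X_def Y_def add.commute)
      then show ?thesis using generated_swap[OF cd] by (simp add: comp_swap)
    next
      case False
      obtain n G where rep: "laurent_rep c d X Y n G lx"
        using laurent_rep_exists[OF chart_on_surf[OF ch], of lx] regular_closed(6)[of a b] ch
        by (auto simp: chart_def)
      have "lx \<notin> range (lconst :: 'a \<Rightarrow> _)"
        by (metis ldeg_lx ldeg_lconst rangeE zero_neq_one)
      from laurent_rep_ldeg_bound[OF cd lc(2) rep lc(3,4) _ _ this] XY False
      \<comment> \<open>The nonconstant function x has degree 1. One weight is thus 1, and the
        balance inequalities 2p <= 3q, 2q <= 3p force the other to be 1 as well.\<close>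
      have "min (ldeg X) (ldeg Y) \<le> 1" unfolding ldeg_lx by linarith
      then have pq: "ldeg X = 1" "ldeg Y = 1" using lc(3,4) XY False by linarith+
      from chart_degree_one[OF ab cd ch pq]
      consider \<alpha> \<beta> where "X = lconst \<alpha> * lx" "Y = lconst \<beta> * ly"
        | \<alpha> \<beta> where "Y = lconst \<alpha> * lx" "X = lconst \<beta> * ly" by blast
      then show ?thesis
      proof cases
        case 1
        then show ?thesis using generated_diagonal[OF ab cd iso] by (simp add: X_def Y_def)
      next
        case 2
        then have "generated a b d c (Q, P, W)"
          using generated_diagonal[OF ab cd(2,1) iso'] by (simp add: X_def Y_def)
        then show ?thesis using generated_swap[OF cd] by (simp add: comp_swap)
      qed
    qed
  qed
  then show ?case by (simp add: \<phi>)
qed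

theorem theorem28:
  fixes a b c d :: "'a::idom poly" and \<phi> :: "'a pmap"
  assumes "a \<in> P3x" and "b \<in> P3x" and "c \<in> P3x" and "d \<in> P3x"
  shows "surf_iso a b c d \<phi> \<longleftrightarrow> generated a b c d \<phi>"
  using surf_iso_imp_generated[OF assms(1-4)] generated_imp_surf_iso by blast

end
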